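(* Let $\mathbf m$ be a unitarily invariant measure on the space $\mathcal H_N$ of $N\times N$ hermitian matrices (in particular, a formal measure generating usual maps, maps with loops or stuffed maps), and let $$\check Z(A)=\int_{\mathcal H_N}d\mathbf m(M)\,\exp\big[N\,\mathrm{Tr}(MA)\big],\qquad A\in\mathcal H_N.$$ Then $$\frac{\check Z(A)}{\check Z(0)}=\sum_{\lambda}\frac{|C_\lambda|}{|\lambda|!}\,N^{|\lambda|}\,\langle\mathcal P_\lambda(M)\rangle\prod_{i=1}^{\ell(\lambda)}\mathrm{Tr}\,A^{\lambda_i},$$ where the sum runs over all partitions $\lambda$ (including the empty one), with the convention that $\langle\mathcal P_\lambda(M)\rangle=0$ whenever $|\lambda|>N$.
   Context: $\langle\cdot\rangle$ is the normalized expectation value with respect to $\mathbf m$. Unitarily invariant means invariant under $M\mapsto UMU^\dagger$ for every unitary $U$. The formal measures generating maps are $$dM\,\exp\Big(-N\,\mathrm{Tr}\tfrac{M^2}{2}+\sum_{h\ge0,k\ge1}\frac{N^{2-2h-k}}{k!}\sum_{d_1,\dots,d_k\ge1}\frac{t_{h;d_1,\dots,d_k}}{d_1\cdots d_k}\prod_{i=1}^k\mathrm{Tr}\,M^{d_i}\Big)$$ (only $t_{0;d}$ nonzero for usual maps; only $t_{0;d}$ and $t_{0;d_1,d_2}$ for maps with loops; all of them for stuffed maps), for which expectation values are formal power series in the $t$'s obtained by expanding around the Gaussian measure. For a partition $\lambda$ of $L\le N$, $\mathcal P_\lambda(M)=\prod_{j=1}^{L}M_{j,\gamma(j)}$, where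 $\gamma$ is any permutation of $\{1,\dots,L\}$ with cycle type $\lambda$; by unitary invariance $\langle\mathcal P_\lambda(M)\rangle$ depends only on $\lambda$. For the empty partition, $\mathcal P_\emptyset=1$. $\ell(\lambda)$ is the number of parts of $\lambda$, $|\lambda|$ their sum, and $C_\lambda$ is the conjugacy class of cycle type $\lambda$ in the symmetric group $\mathfrak S_{|\lambda|}$.
   Formalization: The equality is false as stated (N=1, unit mass at M=1: left side e^A, right side 1+A), since the convention makes the right side a polynomial of degree at most N; it is proved up to O(||A||^{N+1}) as A tends to 0, coefficientwise in the t's for formal measures. *)

theory Defs
  imports
    "HOL-Analysis.Analysis"
    "HOL-Library.Multiset"
    "HOL-Library.Landau_Symbols"
    "HOL-Combinatorics.Combinatorics"
begin

section \<open>Hermitian matrices and unitarily invariant measures\<close>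

definition dagger :: "complex^'n^'m \<Rightarrow> complex^'m^'n" where
  "dagger M = (\<chi> i j. cnj (M $ j $ i))"

definition hermitian_mats :: "(complex^'n^'n) set" where
  "hermitian_mats = {M. dagger M = M}"

definition unitary_mat :: "complex^'n^'n \<Rightarrow> bool" where
  "unitary_mat U \<longleftrightarrow> dagger U ** U = mat 1 \<and> U ** dagger U = mat 1"

text \<open>The library's \<open>M ^ d\<close> is the entrywise power, hence this separate matrix power.\<close>
definition mat_pow :: "complex^'n^'n \<Rightarrow> nat \<Rightarrow> complex^'n^'n" where
  "mat_pow M d = (((**) M) ^^ d) (mat 1)"

definition unitarily_invariant_measure :: "(complex^'n^'n) measure \<Rightarrow> bool" where
  "unitarily_invariant_measure \<mu> \<longleftrightarrow>
     sets \<mu> = sets (restrict_space borel hermitian_mats) \<and>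
     (\<forall>U. unitary_mat U \<longrightarrow> distr \<mu> \<mu> (\<lambda>M. U ** M ** dagger U) = \<mu>)"


section \<open>Partitions, conjugacy classes and the observables \<open>\<P>\<close>\<close>

text \<open>A partition is the multiset of its parts: \<open>|\<lambda>|\<close> is \<open>sum_mset\<close> and \<open>\<ell>(\<lambda>)\<close> is \<open>size\<close>.\<close>
definition partitions :: "nat multiset set" where
  "partitions = {p. 0 \<notin># p}"

definition cycle_type :: "nat \<Rightarrow> (nat \<Rightarrow> nat) \<Rightarrow> nat multiset" where
  "cycle_type L g = image_mset card (mset_set (orbit g ` {1..L}))"

definition conj_class :: "nat multiset \<Rightarrow> (nat \<Rightarrow> nat) set" where
  "conj_class p = {g. g permutes {1..sum_mset p} \<and> cycle_type (sum_mset p) g = p}"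

text \<open>Rows and columns are indexed by the finite type \<open>'n\<close>, with \<open>N = CARD('n)\<close>. The labelling
  \<open>idx\<close> of \<open>'n\<close> by \<open>1, \<dots>, N\<close> gives a meaning to the entry in row \<open>j\<close> and column \<open>g j\<close>.\<close>
definition perm_obs :: "(nat \<Rightarrow> 'n) \<Rightarrow> nat \<Rightarrow> (nat \<Rightarrow> nat) \<Rightarrow> complex^'n^'n \<Rightarrow> complex" where
  "perm_obs idx L g M = (\<Prod>j = 1..L. M $ idx j $ idx (g j))"

text \<open>The sum over all partitions, as a function of the numbers \<open>e \<lambda>\<close> put in place of the
  expectation values of \<open>\<P>\<^sub>\<lambda>\<close>, which count as zero when \<open>|\<lambda>| > N\<close>. With this
  convention it is a polynomial of degree at most \<open>N\<close> in \<open>A\<close>, so it can only agree with a partition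
  function (e.g. \<open>exp (N Tr A\<^sup>2 / 2)\<close> for the Gaussian measure) up to \<open>O(\<parallel>A\<parallel>\<^sup>N\<^sup>+\<^sup>1)\<close>.\<close>
definition power_sum_expansion :: "(nat multiset \<Rightarrow> complex) \<Rightarrow> complex^'n^'n \<Rightarrow> complex" where
  "power_sum_expansion e A =
     (\<Sum>\<^sub>\<infinity>p\<in>partitions.
        of_nat (card (conj_class p)) / fact (sum_mset p) * of_nat CARD('n) ^ sum_mset p
        * (if sum_mset p > CARD('n) then 0 else e p)
        * (\<Prod>d\<in>#p. trace (mat_pow A d)))"


section \<open>Genuine measures\<close>

definition ext_weight :: "complex^'n^'n \<Rightarrow> complex^'n^'n \<Rightarrow> complex" where
  "ext_weight A M = exp (of_nat CARD('n) * trace (M ** A))"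

definition ext_partition :: "(complex^'n^'n) measure \<Rightarrow> complex^'n^'n \<Rightarrow> complex" where
  "ext_partition \<mu> A = integral\<^sup>L \<mu> (ext_weight A)"

definition mean :: "(complex^'n^'n) measure \<Rightarrow> (complex^'n^'n \<Rightarrow> complex) \<Rightarrow> complex" where
  "mean \<mu> f = integral\<^sup>L \<mu> f / integral\<^sup>L \<mu> (\<lambda>_. 1)"


section \<open>Formal measures generating maps\<close>

text \<open>The formal parameter \<open>t\<^bsub>h;d\<^sub>1,\<dots>,d\<^sub>k\<^esub>\<close> is named by the pair \<open>(h, [d\<^sub>1, \<dots>, d\<^sub>k])\<close>. A monomial in
  the parameters is a multiset of names, and a formal power series in them is the function giving
  its coefficients.\<close>
type_synonym param = "nat \<times> nat list"
type_synonym pseries = "param multiset \<Rightarrow> complex"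

definition pseries_mult :: "pseries \<Rightarrow> pseries \<Rightarrow> pseries" where
  "pseries_mult f g = (\<lambda>m. \<Sum>a | a \<subseteq># m. f a * g (m - a))"

text \<open>The quotient exists and is unique whenever the constant term of \<open>g\<close> is nonzero.\<close>
definition pseries_div :: "pseries \<Rightarrow> pseries \<Rightarrow> pseries" where
  "pseries_div f g = (THE q. pseries_mult q g = f)"

definition stuffed_params :: "param set" where
  "stuffed_params = {(h, ds). ds \<noteq> [] \<and> 0 \<notin> set ds}"

definition loop_params :: "param set" where
  "loop_params = {(h, ds) \<in> stuffed_params. h = 0 \<and> length ds \<le> 2}"

definition usual_params :: "param set" where
  "usual_params = {(h, ds) \<in> stuffed_params. h = 0 \<and> length ds = 1}"

text \<open>\<open>(X\<^sub>i\<^sub>j + X\<^sub>j\<^sub>i)/2 + \<i> (X\<^sub>i\<^sub>j - X\<^sub>j\<^sub>i)/2\<close> is a linear isometry from the real matrices onto the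
  Hermitian ones (with inverse \<open>X\<^sub>i\<^sub>j = Re M\<^sub>i\<^sub>j + Im M\<^sub>i\<^sub>j\<close>). The image of Lebesgue measure is \<open>dM\<close>
  up to a constant factor, which cancels in normalized quantities.\<close>
definition hermitian_of_real :: "real^'n^'n \<Rightarrow> complex^'n^'n" where
  "hermitian_of_real X =
     (\<chi> i j. Complex ((X $ i $ j + X $ j $ i) / 2) ((X $ i $ j - X $ j $ i) / 2))"

definition hermitian_lebesgue :: "(complex^'n^'n) measure" where
  "hermitian_lebesgue = distr lborel (restrict_space borel hermitian_mats) hermitian_of_real"

definition gaussian :: "(complex^'n^'n) measure" where
  "gaussian = density hermitian_lebesgue
     (\<lambda>M. ennreal (exp (- real CARD('n) * Re (trace (mat_pow M 2)) / 2)))"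

text \<open>The coefficient of \<open>t\<^bsub>h;d\<^sub>1,\<dots>,d\<^sub>k\<^esub>\<close> in the exponent of the density.\<close>
definition vertex :: "complex^'n^'n \<Rightarrow> param \<Rightarrow> complex" where
  "vertex M = (\<lambda>(h, ds).
     of_nat CARD('n) powi (2 - 2 * int h - int (length ds)) / fact (length ds)
     / of_nat (prod_list ds) * (\<Prod>d\<leftarrow>ds. trace (mat_pow M d)))"

text \<open>The formal power series \<open>exp (\<Sum>i\<in>K. t\<^sub>i v\<^sub>i)\<close> has the coefficient
  \<open>\<Prod>i. v\<^sub>i ^ n\<^sub>i / n\<^sub>i!\<close> at the monomial \<open>\<Prod>i. t\<^sub>i ^ n\<^sub>i\<close> if this monomial only involves parameters
  in \<open>K\<close>, and the coefficient zero otherwise.\<close>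
definition map_weight :: "param set \<Rightarrow> complex^'n^'n \<Rightarrow> pseries" where
  "map_weight K M = (\<lambda>m. if set_mset m \<subseteq> K
     then \<Prod>i\<in>set_mset m. vertex M i ^ count m i / fact (count m i) else 0)"

text \<open>Integration against the formal measure: expansion around the Gaussian, term by term.\<close>
definition formal_integral :: "param set \<Rightarrow> (complex^'n^'n \<Rightarrow> complex) \<Rightarrow> pseries" where
  "formal_integral K f = (\<lambda>m. integral\<^sup>L gaussian (\<lambda>M. map_weight K M m * f M))"

definition formal_ext_partition :: "param set \<Rightarrow> complex^'n^'n \<Rightarrow> pseries" where
  "formal_ext_partition K A = formal_integral K (ext_weight A)"

definition formal_mean :: "param set \<Rightarrow> (complex^'n^'n \<Rightarrow> complex) \<Rightarrow> pseries" where
  "formal_mean K f = pseries_div (formal_integral K f) (formal_integral K (\<lambda>_ :: complex^'n^'n. 1))"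

end

theory Submission
  imports Defs "HOL-Probability.Distributions"
begin

text \<open>Let \<open>k \<le> N\<close>. The moments \<open>\<langle>\<Prod>\<^sub>a M\<^bsub>i(a) j(a)\<^esub>\<rangle>\<close>, \<open>1 \<le> a \<le> k\<close>, of a unitarily invariant weight vanish by
  invariance under diagonal phases unless each value occurs equally often in \<open>i\<close> and in \<open>j\<close>.
  Differentiating the invariance under the rotations in the plane of two values \<open>v = i(a)\<close> and \<open>q\<close>,
  with \<open>q\<close> not occurring in \<open>i\<close> or \<open>j\<close>, shows that the moment is the sum over all \<open>b\<close> with
  \<open>j(b) = v\<close> of the moments with \<open>i(a)\<close> and \<open>j(b)\<close> replaced by \<open>q\<close>. As \<open>k \<le> N\<close>, this reduces
  every moment to moments with injective \<open>i\<close>, which equal \<open>\<langle>\<P>\<^sub>\<lambda>\<rangle>\<close> by invariance under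
  permutation matrices. Hence the moment is the sum of \<open>\<langle>\<P>\<^bsub>type(g)\<^esub>\<rangle>\<close> over all permutations \<open>g\<close>
  with \<open>j = i \<circ> g\<close>; summation against \<open>\<Prod>\<^sub>a A\<^bsub>j(a) i(a)\<^esub>\<close> gives \<open>\<langle>(Tr M A)\<^sup>k\<rangle>\<close> as a combination of
  products of traces of powers of \<open>A\<close>. The remainder of the exponential series is
  \<open>O(\<parallel>A\<parallel>\<^sup>N\<^sup>+\<^sup>1)\<close> because all exponential moments are finite.

  A coefficient of a quotient of formal integrals is the Gaussian integral against a weight that is
  a polynomial in traces of powers of \<open>M\<close>, so formal measures are covered by the same argument.\<close>

section \<open>Cycles of permutations and traces of powers\<close>

text \<open>The powers of \<open>f\<close> below the first return time
  \<open>funpow_dist1 f x x\<close> enumerate the orbit of \<open>x\<close> without repetition, so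
  this time is the length of the cycle.\<close>

lemma funpow_eq_iff_mod_card_orbit:
  assumes "permutation f"
  shows "(f ^^ s) x = (f ^^ t) x \<longleftrightarrow> s mod card (orbit f x) = t mod card (orbit f x)"
    and "bij_betw (\<lambda>t. (f ^^ t) x) {..<card (orbit f x)} (orbit f x)"
    and "(f ^^ card (orbit f x)) x = x"
proof -
  have x: "x \<in> orbit f x" using assms by (rule permutation_self_in_orbit)
  let ?d = "funpow_dist1 f x x"
  have im: "orbit f x = (\<lambda>n. (f ^^ n) x) ` {0..<?d}" by (rule orbit_conv_funpow_dist1[OF x])
  have inj: "inj_on (\<lambda>n. (f ^^ n) x) {0..<?d}" by (rule inj_on_funpow_dist1[OF x])
  have d: "card (orbit f x) = ?d" using card_image[OF inj] im by simp
  show "bij_betw (\<lambda>t. (f ^^ t) x) {..<card (orbit f x)} (orbit f x)"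
    using im inj unfolding d bij_betw_def by (simp add: atLeast0LessThan)
  have per: "(f ^^ ?d) x = x" by (rule funpow_dist1_prop[OF x])
  then show "(f ^^ card (orbit f x)) x = x" by (simp only: d)
  have m: "(f ^^ n) x = (f ^^ (n mod ?d)) x" for n
    using funpow_mod_eq[OF per] by metis
  show "(f ^^ s) x = (f ^^ t) x \<longleftrightarrow> s mod card (orbit f x) = t mod card (orbit f x)"
  proof
    assume "(f ^^ s) x = (f ^^ t) x"
    then have "(f ^^ (s mod ?d)) x = (f ^^ (t mod ?d)) x" using m by metis
    then show "s mod card (orbit f x) = t mod card (orbit f x)"
      unfolding d using inj_onD[OF inj, of "s mod ?d" "t mod ?d"] by simp
  next
    assume "s mod card (orbit f x) = t mod card (orbit f x)"
    then show "(f ^^ s) x = (f ^^ t) x" using m d by metis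
  qed
qed

lemma permutes_orbit_eq_iff:
  assumes "f permutes S" "finite S"
  shows "orbit f x = orbit f y \<longleftrightarrow> x \<in> orbit f y"
  using assms cyclic_on_orbit[OF assms, of y] orbit_cyclic_eq3[of f "orbit f y" x]
    permutation_self_in_orbit[of f x] by (auto simp: permutation_permutes)

text \<open>An arbitrary bijection \<open>h\<close> from \<open>A\<close> to \<open>B\<close> pulls
  \<open>g\<close> back to \<open>A\<close>. Two functions on the same finite set with equal image
  multisets differ by a permutation, and composing it with \<open>h\<close> gives
  \<open>\<pi>\<close>.\<close>

lemma bij_betw_of_image_mset_eq:
  assumes "finite A" "finite B" "image_mset f (mset_set A) = image_mset g (mset_set B)"
  obtains \<pi> where "bij_betw \<pi> A B" "\<And>x. x \<in> A \<Longrightarrow> f x = g (\<pi> x)"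
proof -
  have "card A = card B"
    using arg_cong[OF assms(3), of size] by simp
  then obtain h where h: "bij_betw h A B"
    using assms(1,2) finite_same_card_bij by blast
  have "mset_set B = image_mset h (mset_set A)"
    using h by (simp add: bij_betw_def image_mset_mset_set)
  then have "image_mset f (mset_set A) = image_mset (g \<circ> h) (mset_set A)"
    using assms(3) by (simp add: image_mset.compositionality)
  then obtain p where p: "p permutes A" "\<forall>x\<in>A. f x = (g \<circ> h) (p x)"
    using image_mset_eq_implies_permutes[OF assms(1), of f "g \<circ> h"] by blast
  have "bij_betw (h \<circ> p) A B"
    using bij_betw_trans[OF permutes_imp_bij[OF p(1)] h] .
  then show ?thesis using p(2) that[of "h \<circ> p"] by auto
qed

text \<open>Base points are chosen in corresponding cycles of \<open>g\<close> and \<open>g'\<close>; the conjugating bijection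
  sends \<open>g\<^sup>t r\<close> to \<open>g'\<^sup>t r'\<close>.\<close>
lemma conjugate_of_cycle_type_eq:
  assumes g: "g permutes {1..k}" and g': "g' permutes {1..k}"
    and ct: "cycle_type k g = cycle_type k g'"
  obtains \<tau> where "bij_betw \<tau> {1..k} {1..k}" "\<And>a. a \<in> {1..k} \<Longrightarrow> \<tau> (g a) = g' (\<tau> a)"
proof -
  let ?S = "{1..k}"
  have pg: "permutation g" "permutation g'" using g g' by (auto simp: permutation_permutes)
  \<comment> \<open>Equal cycle types pair the cycles of \<open>g\<close> with cycles of
    \<open>g'\<close> of the same length; \<open>f\<close> is this pairing.\<close>
  have "image_mset card (mset_set (orbit g ` ?S)) = image_mset card (mset_set (orbit g' ` ?S))"
    using ct by (simp add: cycle_type_def)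
  from bij_betw_of_image_mset_eq[OF _ _ this] obtain f
    where f: "bij_betw f (orbit g ` ?S) (orbit g' ` ?S)"
      and fc: "\<And>Q. Q \<in> orbit g ` ?S \<Longrightarrow> card Q = card (f Q)"
    by (metis finite_imageI finite_atLeastAtMost)
  define r where "r Q = (SOME x. x \<in> ?S \<and> orbit g x = Q)" for Q
  define r' where "r' Q = (SOME x. x \<in> ?S \<and> orbit g' x = Q)" for Q
  have r: "r Q \<in> ?S \<and> orbit g (r Q) = Q" if "Q \<in> orbit g ` ?S" for Q
    unfolding r_def by (rule someI_ex) (use that in auto)
  have r': "r' Q \<in> ?S \<and> orbit g' (r' Q) = Q" if "Q \<in> orbit g' ` ?S" for Q
    unfolding r'_def by (rule someI_ex) (use that in auto)
  define t where "t a = (SOME t. (g ^^ t) (r (orbit g a)) = a)" for a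
  have t: "(g ^^ t a) (r (orbit g a)) = a" if "a \<in> ?S" for a
    unfolding t_def
  proof (rule someI_ex)
    have "a \<in> orbit g (r (orbit g a))"
      using r[OF imageI[OF that]] permutation_self_in_orbit[OF pg(1), of a] by simp
    then show "\<exists>t. (g ^^ t) (r (orbit g a)) = a"
      unfolding orbit_altdef[of g "r (orbit g a)"] by (elim CollectE exE conjE) (rule exI, erule sym)
  qed
  define \<tau> where "\<tau> a = (g' ^^ t a) (r' (f (orbit g a)))" for a
  have fO: "f (orbit g a) \<in> orbit g' ` ?S" if "a \<in> ?S" for a
    using bij_betwE[OF f] that by blast
  \<comment> \<open>Different exponents may reach the same element of a cycle. Paired cycles have
    equal length, so the corresponding elements of the other cycle then agree as well.\<close>
  have eq: "(g' ^^ m) (r' (f Q)) = (g' ^^ n) (r' (f Q))"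
    if "Q \<in> orbit g ` ?S" "(g ^^ m) (r Q) = (g ^^ n) (r Q)" for m n Q
  proof -
    have c: "card (orbit g (r Q)) = card (orbit g' (r' (f Q)))"
      using r[OF that(1)] r'[OF bij_betwE[OF f, rule_format, OF that(1)]] fc[OF that(1)] by metis
    show ?thesis using that(2)
      unfolding funpow_eq_iff_mod_card_orbit(1)[OF pg(1)] funpow_eq_iff_mod_card_orbit(1)[OF pg(2)] c .
  qed
  have gS: "g a \<in> ?S" if "a \<in> ?S" for a using permutes_in_image[OF g] that by blast
  have g'S: "(g' ^^ n) a \<in> ?S" if "a \<in> ?S" for a n
    using that permutes_in_image[OF g'] by (induction n) auto
  have conj: "\<tau> (g a) = g' (\<tau> a)" if a: "a \<in> ?S" for a
  proof -
    have o: "orbit g (g a) = orbit g a" by (rule permutation_orbit_step[OF pg(1)])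
    have "(g ^^ t (g a)) (r (orbit g a)) = (g ^^ Suc (t a)) (r (orbit g a))"
      using t[OF a] t[OF gS[OF a]] o by simp
    from eq[OF imageI[OF a] this] show ?thesis unfolding \<tau>_def o by simp
  qed
  \<comment> \<open>Surjectivity suffices, since a surjection of a finite set onto itself is
    injective.\<close>
  have surj: "\<tau> ` ?S = ?S"
  proof
    show "\<tau> ` ?S \<subseteq> ?S" 
    proof (intro image_subsetI)
      fix a assume "a \<in> ?S"
      then show "\<tau> a \<in> ?S" unfolding \<tau>_def using r'[OF fO] by (intro g'S) blast
    qed
    show "?S \<subseteq> \<tau> ` ?S"
    proof
      fix b assume b: "b \<in> ?S"
      then obtain Q where Q: "Q \<in> orbit g ` ?S" "f Q = orbit g' b"
        using f unfolding bij_betw_def by (metis image_iff imageI)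
      have "f Q \<in> orbit g' ` ?S" unfolding Q(2) using b by (rule imageI)
      from r'[OF this] have "b \<in> orbit g' (r' (f Q))"
        unfolding Q(2) using permutation_self_in_orbit[OF pg(2), of b] by simp
      then obtain n where n: "b = (g' ^^ n) (r' (f Q))" by (auto simp: orbit_altdef)
      define a where "a = (g ^^ n) (r Q)"
      have rO: "r Q \<in> ?S" "orbit g (r Q) = Q" using r[OF Q(1)] by auto
      have aO: "a \<in> orbit g (r Q)"
        unfolding a_def by (rule funpow_in_orbit[OF permutation_self_in_orbit[OF pg(1)]])
      have aS: "a \<in> ?S" using aO permutes_orbit_subset[OF g rO(1)] by blast
      have oa: "orbit g a = Q"
        using aO permutes_orbit_eq_iff[OF g, of a "r Q"] rO(2) by simp
      have "(g ^^ t a) (r Q) = (g ^^ n) (r Q)" using t[OF aS] oa a_def by simp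
      from eq[OF Q(1) this] have "\<tau> a = b" unfolding \<tau>_def oa n .
      then show "b \<in> \<tau> ` ?S" using aS by blast
    qed
  qed
  have "bij_betw \<tau> ?S ?S"
    using surj by (simp add: bij_betw_def eq_card_imp_inj_on)
  then show ?thesis using conj that by blast
qed

section \<open>Sums over index tuples\<close>

lemma sum_PiE_insert:
  assumes "x \<notin> A"
  shows "(\<Sum>g\<in>PiE (insert x A) (\<lambda>_. B). F g) = (\<Sum>y\<in>B. \<Sum>g\<in>PiE A (\<lambda>_. B). F (g(x := y)))"
proof -
  have "(\<Sum>g\<in>PiE (insert x A) (\<lambda>_. B). F g) = (\<Sum>(y, g)\<in>B \<times> PiE A (\<lambda>_. B). F (g(x := y)))"
    unfolding PiE_insert_eq using inj_combinator[OF assms, of "\<lambda>_. B"]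
    by (subst sum.reindex) (auto simp: case_prod_unfold)
  then show ?thesis by (simp add: sum.cartesian_product)
qed

text \<open>\<open>F\<close> and \<open>G\<close> read a tuple only on \<open>A\<close> and only on
  \<open>B\<close>, so splitting each tuple into its two restrictions factorises the sum.\<close>

lemma sum_PiE_Un:
  assumes "A \<inter> B = {}"
    and "\<And>g g'. (\<And>x. x \<in> A \<Longrightarrow> g x = g' x) \<Longrightarrow> F g = F g'"
    and "\<And>g g'. (\<And>x. x \<in> B \<Longrightarrow> g x = g' x) \<Longrightarrow> G g = G g'"
  shows "(\<Sum>g\<in>PiE (A \<union> B) (\<lambda>_. C). F g * G g :: 'a :: comm_semiring_0)
    = (\<Sum>g\<in>PiE A (\<lambda>_. C). F g) * (\<Sum>g\<in>PiE B (\<lambda>_. C). G g)"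
proof -
  have "(\<Sum>g\<in>PiE (A \<union> B) (\<lambda>_. C). F g * G g)
      = (\<Sum>(g, h)\<in>PiE A (\<lambda>_. C) \<times> PiE B (\<lambda>_. C). F g * G h)"
  proof (rule sum.reindex_bij_witness[of _
        "\<lambda>(g, h) x. if x \<in> A then g x else if x \<in> B then h x else undefined"
        "\<lambda>g. (restrict g A, restrict g B)"], goal_cases)
    case (1 g) then show ?case by (auto simp: PiE_def extensional_def fun_eq_iff)
  next
    case (2 g) then show ?case by (auto simp: PiE_def)
  next
    case (3 p)
    then show ?case using assms(1) by (auto simp: PiE_def extensional_def fun_eq_iff split: prod.splits)
  next
    case (4 p)
    then show ?case by (auto simp: PiE_def extensional_def Pi_def split: prod.splits)
  next
    case (5 g)
    then show ?case using assms(2)[of "restrict g A" g] assms(3)[of "restrict g B" g] by auto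
  qed
  then show ?thesis by (simp add: sum_product sum.cartesian_product)
qed

lemma sum_PiE_reindex:
  assumes h: "bij_betw h T S"
  shows "(\<Sum>i\<in>PiE S (\<lambda>_. B). F i) = (\<Sum>i\<in>PiE T (\<lambda>_. B). F (\<lambda>x\<in>S. i (inv_into T h x)))"
proof -
  have i1: "inv_into T h (h x) = x" if "x \<in> T" for x
    using h that by (simp add: bij_betw_def)
  have i2: "h (inv_into T h x) = x" "inv_into T h x \<in> T" if "x \<in> S" for x
    using h that by (simp_all add: bij_betw_inv_into_right bij_betw_def inv_into_into)
  have hS: "h x \<in> S" if "x \<in> T" for x using h that by (auto simp: bij_betw_def)
  show ?thesis
    by (rule sum.reindex_bij_witness[of _ "\<lambda>i. \<lambda>x\<in>S. i (inv_into T h x)" "\<lambda>i. \<lambda>x\<in>T. i (h x)"])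
      (auto simp: i1 i2 hS fun_eq_iff PiE_def extensional_def Pi_def cong: restrict_cong)
qed

text \<open>The tuple lists the vertices of a path that starts at \<open>v = i 0\<close>; the end
  \<open>u\<close> is kept outside, so that setting \<open>u = i 0\<close> closes the path when the
  trace is taken. Rows carry the later vertex, to match the factors \<open>A $ i (g a) $ i a\<close>
  below.\<close>

lemma mat_pow_Suc_path_sum:
  fixes A :: "complex^'n^'n"
  shows "mat_pow A (Suc e) $ u $ v =
    (\<Sum>i\<in>PiE {..<Suc e} (\<lambda>_. UNIV).
      of_bool (i 0 = v) * (\<Prod>t<e. A $ i (Suc t) $ i t) * A $ u $ i e)"
proof (induction e arbitrary: u)
  case 0
  have l: "{..<Suc 0} = insert 0 {}" by auto
  show ?case unfolding l by (subst sum_PiE_insert) (simp_all add: mat_pow_def)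
next
  case (Suc e)
  have l: "{..<Suc (Suc e)} = insert (Suc e) {..<Suc e}" by auto
  have "mat_pow A (Suc (Suc e)) $ u $ v = (\<Sum>w\<in>UNIV. A $ u $ w * mat_pow A (Suc e) $ w $ v)"
    by (simp add: mat_pow_def matrix_matrix_mult_def)
  also have "\<dots> = (\<Sum>w\<in>UNIV. \<Sum>i\<in>PiE {..<Suc e} (\<lambda>_. UNIV).
      of_bool (i 0 = v) * ((\<Prod>t<e. A $ i (Suc t) $ i t) * A $ w $ i e) * A $ u $ w)"
    unfolding Suc.IH by (simp add: sum_distrib_left mult_ac)
  also have "\<dots> = (\<Sum>w\<in>UNIV. \<Sum>i\<in>PiE {..<Suc e} (\<lambda>_. UNIV).
      of_bool ((i(Suc e := w)) 0 = v) * (\<Prod>t<Suc e. A $ (i(Suc e := w)) (Suc t) $ (i(Suc e := w)) t)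
      * A $ u $ (i(Suc e := w)) (Suc e))"
  proof (intro sum.cong refl)
    fix w and i :: "nat \<Rightarrow> 'n"
    have "(\<Prod>t<e. A $ (i(Suc e := w)) (Suc t) $ (i(Suc e := w)) t) = (\<Prod>t<e. A $ i (Suc t) $ i t)"
      by (intro prod.cong) auto
    then show "of_bool (i 0 = v) * ((\<Prod>t<e. A $ i (Suc t) $ i t) * A $ w $ i e) * A $ u $ w
      = of_bool ((i(Suc e := w)) 0 = v)
        * (\<Prod>t<Suc e. A $ (i(Suc e := w)) (Suc t) $ (i(Suc e := w)) t)
        * A $ u $ (i(Suc e := w)) (Suc e)"
      by simp
  qed
  also have "\<dots> = (\<Sum>i\<in>PiE {..<Suc (Suc e)} (\<lambda>_. UNIV).
      of_bool (i 0 = v) * (\<Prod>t<Suc e. A $ i (Suc t) $ i t) * A $ u $ i (Suc e))"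
    unfolding l by (rule sum_PiE_insert[symmetric]) simp
  finally show ?case .
qed

text \<open>Closing the paths turns them into cyclic tuples of length \<open>d\<close>. For
  \<open>d = 0\<close> the trace would be \<open>CARD('n)\<close>, while the sum over the single
  empty tuple is 1.\<close>

lemma trace_mat_pow_cycle_sum:
  fixes A :: "complex^'n^'n"
  assumes "0 < d"
  shows "trace (mat_pow A d) =
    (\<Sum>i\<in>PiE {..<d} (\<lambda>_. UNIV). \<Prod>t<d. A $ i (Suc t mod d) $ i t)"
proof -
  obtain e where d: "d = Suc e" using assms by (cases d) auto
  have e: "(\<Prod>t<d. A $ i (Suc t mod d) $ i t) = (\<Prod>t<e. A $ i (Suc t) $ i t) * A $ i 0 $ i e" for i
    by (simp add: d)
  have "trace (mat_pow A d) = (\<Sum>i\<in>PiE {..<Suc e} (\<lambda>_. UNIV). \<Sum>u\<in>UNIV.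
      of_bool (i 0 = u) * ((\<Prod>t<e. A $ i (Suc t) $ i t) * A $ u $ i e))"
    unfolding trace_def d mat_pow_Suc_path_sum by (subst sum.swap) (simp add: mult_ac)
  then show ?thesis unfolding e by (simp add: d)
qed

text \<open>Enumerating the orbit as \<open>h t = (f ^^ t) x\<close> turns \<open>f\<close> into the
  successor modulo the length of the cycle.\<close>

lemma cycle_sum:
  fixes A :: "complex^'n^'n"
  assumes "permutation f"
  shows "(\<Sum>i\<in>PiE (orbit f x) (\<lambda>_. UNIV). \<Prod>a\<in>orbit f x. A $ i (f a) $ i a)
    = trace (mat_pow A (card (orbit f x)))"
proof -
  define d where "d = card (orbit f x)"
  define h where "h t = (f ^^ t) x" for t
  have h: "bij_betw h {..<d} (orbit f x)"
    using funpow_eq_iff_mod_card_orbit(2)[OF assms, of x] unfolding h_def d_def .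
  have d0: "0 < d"
    using finite_orbit[OF permutation_self_in_orbit[OF assms]] orbit_nonempty[of f x]
    by (simp add: d_def card_gt_0_iff)
  have hO: "h t \<in> orbit f x" if "t < d" for t
    using h that by (auto simp: bij_betw_def)
  have inv: "inv_into {..<d} h (h t) = t" if "t < d" for t
    using h that by (simp add: bij_betw_def)
  have fh: "f (h t) = h (Suc t mod d)" if "t < d" for t
    using funpow_eq_iff_mod_card_orbit(1)[OF assms, of "Suc t" x "Suc t mod d"]
    by (simp add: h_def d_def)
  have "(\<Sum>i\<in>PiE (orbit f x) (\<lambda>_. UNIV). \<Prod>a\<in>orbit f x. A $ i (f a) $ i a)
      = (\<Sum>i\<in>PiE {..<d} (\<lambda>_. UNIV). \<Prod>a\<in>orbit f x.
          A $ (\<lambda>y\<in>orbit f x. i (inv_into {..<d} h y)) (f a)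
            $ (\<lambda>y\<in>orbit f x. i (inv_into {..<d} h y)) a)"
    by (rule sum_PiE_reindex[OF h])
  also have "\<dots> = (\<Sum>i\<in>PiE {..<d} (\<lambda>_. UNIV). \<Prod>t<d. A $ i (Suc t mod d) $ i t)"
    by (intro sum.cong refl, subst prod.reindex_bij_betw[OF h, symmetric])
      (use d0 in \<open>auto intro!: prod.cong simp: fh hO inv\<close>)
  finally show ?thesis using trace_mat_pow_cycle_sum[OF d0, of A] by (simp add: d_def)
qed

lemma sum_PiE_Union:
  fixes F :: "'a set \<Rightarrow> ('a \<Rightarrow> 'b) \<Rightarrow> 'c :: comm_semiring_1"
  assumes "finite \<O>" "disjoint \<O>"
    and "\<And>Q g g'. Q \<in> \<O> \<Longrightarrow> (\<And>x. x \<in> Q \<Longrightarrow> g x = g' x) \<Longrightarrow> F Q g = F Q g'"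
  shows "(\<Sum>g\<in>PiE (\<Union>\<O>) (\<lambda>_. C). \<Prod>Q\<in>\<O>. F Q g) = (\<Prod>Q\<in>\<O>. \<Sum>g\<in>PiE Q (\<lambda>_. C). F Q g)"
  using assms
proof (induction \<O> rule: finite_induct)
  case empty
  show ?case by simp
next
  case (insert P \<O>)
  have "P \<inter> R = {}" if "R \<in> \<O>" for R
    using disjointD[OF insert.prems(1), of P R] that insert.hyps(2) by auto
  then have dis: "P \<inter> \<Union>\<O> = {}" by blast
  have IH: "(\<Sum>g\<in>PiE (\<Union>\<O>) (\<lambda>_. C). \<Prod>Q\<in>\<O>. F Q g) = (\<Prod>Q\<in>\<O>. \<Sum>g\<in>PiE Q (\<lambda>_. C). F Q g)"
  proof (rule insert.IH)
    show "disjoint \<O>" using insert.prems(1) by (auto simp: disjoint_def)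
    show "F Q g = F Q g'" if "Q \<in> \<O>" "\<And>x. x \<in> Q \<Longrightarrow> g x = g' x" for Q g g'
      using insert.prems(2)[of Q g g'] that by blast
  qed
  have "(\<Sum>g\<in>PiE (\<Union>(insert P \<O>)) (\<lambda>_. C). \<Prod>Q\<in>insert P \<O>. F Q g)
      = (\<Sum>g\<in>PiE (P \<union> \<Union>\<O>) (\<lambda>_. C). F P g * (\<Prod>Q\<in>\<O>. F Q g))"
    using insert.hyps by simp
  also have "\<dots> = (\<Sum>g\<in>PiE P (\<lambda>_. C). F P g) * (\<Sum>g\<in>PiE (\<Union>\<O>) (\<lambda>_. C). \<Prod>Q\<in>\<O>. F Q g)"
  proof (rule sum_PiE_Un[OF dis])
    show "F P g = F P g'" if "\<And>x. x \<in> P \<Longrightarrow> g x = g' x" for g g'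
      by (rule insert.prems(2)) (use that in auto)
    show "(\<Prod>Q\<in>\<O>. F Q g) = (\<Prod>Q\<in>\<O>. F Q g')" if "\<And>x. x \<in> \<Union>\<O> \<Longrightarrow> g x = g' x" for g g'
      using that by (intro prod.cong refl insert.prems(2)) auto
  qed
  finally show ?case using insert.hyps IH by simp
qed

lemma orbits_partition:
  assumes g: "g permutes S" "finite S"
  shows "\<Union>(orbit g ` S) = S" "disjoint (orbit g ` S)" "\<And>P. P \<in> orbit g ` S \<Longrightarrow> finite P"
proof -
  have pg: "permutation g" using g by (auto simp: permutation_permutes)
  show "\<Union>(orbit g ` S) = S"
  proof
    show "S \<subseteq> \<Union>(orbit g ` S)" using permutation_self_in_orbit[OF pg] by auto
    show "\<Union>(orbit g ` S) \<subseteq> S" using permutes_orbit_subset[OF g(1)] by (intro UN_least)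
  qed
  show "disjoint (orbit g ` S)"
    unfolding disjoint_def
  proof (intro ballI impI)
    fix P Q assume "P \<in> orbit g ` S" "Q \<in> orbit g ` S" "P \<noteq> Q"
    then obtain x y where xy: "P = orbit g x" "Q = orbit g y" by blast
    have "P = Q" if z: "z \<in> P" "z \<in> Q" for z
      using z permutes_orbit_eq_iff[OF g] unfolding xy by metis
    with \<open>P \<noteq> Q\<close> show "P \<inter> Q = {}" by blast
  qed
  show "finite P" if "P \<in> orbit g ` S" for P
    using finite_orbit[OF permutation_self_in_orbit[OF pg]] that by auto
qed

lemma cycle_type_partition:
  assumes g: "g permutes {1..k}"
  shows "cycle_type k g \<in> partitions" "sum_mset (cycle_type k g) = k"
proof -
  note orb = orbits_partition[OF g finite_atLeastAtMost]
  have "sum_mset (cycle_type k g) = (\<Sum>P\<in>orbit g ` {1..k}. card P)"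
    by (simp add: cycle_type_def sum_unfold_sum_mset)
  also have "\<dots> = card (\<Union>(orbit g ` {1..k}))"
    using card_Union_disjoint[OF orb(2,3)] by simp
  finally show "sum_mset (cycle_type k g) = k" using orb(1) by simp
  show "cycle_type k g \<in> partitions"
    unfolding partitions_def cycle_type_def
    using orb(3) by (auto simp: orbit_nonempty)
qed

text \<open>Since \<open>g\<close> maps each cycle to itself, every factor involves indices of one
  cycle only. The sum therefore factorises over the cycles, and a cycle of length \<open>d\<close>
  contributes the trace of the \<open>d\<close>-th power.\<close>

lemma perm_sum_eq_prod_trace:
  fixes A :: "complex^'n^'n"
  assumes g: "g permutes {1..k}"
  shows "(\<Sum>i\<in>PiE {1..k} (\<lambda>_. UNIV). \<Prod>a\<in>{1..k}. A $ i (g a) $ i a)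
    = (\<Prod>d\<in>#cycle_type k g. trace (mat_pow A d))"
proof -
  let ?O = "orbit g ` {1..k}"
  have pg: "permutation g" using g by (auto simp: permutation_permutes)
  note orb = orbits_partition[OF g finite_atLeastAtMost]
  have U: "{1..k} = \<Union>?O" using orb(1) by simp
  note dis = orb(2)
  have fin: "finite ?O" "\<And>P. P \<in> ?O \<Longrightarrow> finite P" using orb(3) by auto
  have "(\<Sum>i\<in>PiE {1..k} (\<lambda>_. UNIV). \<Prod>a\<in>{1..k}. A $ i (g a) $ i a)
      = (\<Sum>i\<in>PiE (\<Union>?O) (\<lambda>_. UNIV). \<Prod>P\<in>?O. \<Prod>a\<in>P. A $ i (g a) $ i a)"
    unfolding U[symmetric]
  proof (intro sum.cong refl)
    fix i
    show "(\<Prod>a\<in>{1..k}. A $ i (g a) $ i a) = (\<Prod>P\<in>?O. \<Prod>a\<in>P. A $ i (g a) $ i a)"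
      using fin dis by (subst U, subst prod.Union_disjoint) (auto simp: disjoint_def)
  qed
  also have "\<dots> = (\<Prod>P\<in>?O. \<Sum>i\<in>PiE P (\<lambda>_. UNIV). \<Prod>a\<in>P. A $ i (g a) $ i a)"
  proof (rule sum_PiE_Union[OF fin(1) dis])
    fix P and i i' :: "nat \<Rightarrow> 'n"
    assume P: "P \<in> ?O" and ii: "\<And>x. x \<in> P \<Longrightarrow> i x = i' x"
    have "g a \<in> P" if "a \<in> P" for a using P that by (auto intro: orbit.step)
    then show "(\<Prod>a\<in>P. A $ i (g a) $ i a) = (\<Prod>a\<in>P. A $ i' (g a) $ i' a)"
      using ii by (intro prod.cong) auto
  qed
  also have "\<dots> = (\<Prod>P\<in>?O. trace (mat_pow A (card P)))"
    using cycle_sum[OF pg] by (intro prod.cong) auto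
  also have "\<dots> = (\<Prod>d\<in>#cycle_type k g. trace (mat_pow A d))"
    by (simp add: cycle_type_def image_mset.compositionality comp_def prod_unfold_prod_mset)
  finally show ?thesis .
qed

section \<open>Moments invariant under rotations\<close>

text \<open>The value that a moment with row indices \<open>i\<close> and column indices
  \<open>j\<close> will turn out to have; \<open>c \<sigma>\<close> stands for the moment of a tuple
  of distinct row indices whose column indices are permuted by \<open>\<sigma>\<close>.\<close>

definition permutation_sum :: "'a set \<Rightarrow> (('a \<Rightarrow> 'a) \<Rightarrow> complex) \<Rightarrow> ('a \<Rightarrow> 'b) \<Rightarrow> ('a \<Rightarrow> 'b) \<Rightarrow> complex"
  where "permutation_sum S c i j = (\<Sum>\<sigma> | \<sigma> permutes S. if \<forall>a\<in>S. j a = i (\<sigma> a) then c \<sigma> else 0)"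

text \<open>A permutation with \<open>j = i \<circ> \<sigma>\<close> is counted exactly once on the
  right, namely for the \<open>b\<close> with \<open>\<sigma> b = a\<close>: as \<open>q\<close> is
  no value of \<open>i\<close>, the new entry at \<open>b\<close> can only be matched with the new
  entry at \<open>a\<close>.\<close>

lemma permutation_sum_fresh:
  assumes S: "finite S" and a: "a \<in> S" and q: "q \<notin> i ` S" "q \<notin> j ` S"
  shows "permutation_sum S c i j
    = (\<Sum>b | b \<in> S \<and> j b = i a. permutation_sum S c (i(a := q)) (j(b := q)))"
proof -
  have *: "(if \<forall>x\<in>S. j x = i (\<sigma> x) then c \<sigma> else 0)
      = (\<Sum>b | b \<in> S \<and> j b = i a.
          if \<forall>x\<in>S. (j(b := q)) x = (i(a := q)) (\<sigma> x) then c \<sigma> else 0)"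
    if \<sigma>: "\<sigma> permutes S" for \<sigma>
  proof -
    obtain b0 where b0: "b0 \<in> S" "\<sigma> b0 = a"
      using permutes_image[OF \<sigma>] a by (metis imageE)
    have inj: "\<sigma> x = a \<longleftrightarrow> x = b0" for x
      using permutes_inj[OF \<sigma>] b0(2) by (metis injD)
    have \<sigma>S: "\<sigma> x \<in> S" if "x \<in> S" for x using permutes_in_image[OF \<sigma>] that by simp
    have eq: "(\<forall>x\<in>S. (j(b := q)) x = (i(a := q)) (\<sigma> x)) \<longleftrightarrow> b = b0 \<and> (\<forall>x\<in>S. j x = i (\<sigma> x))"
      if b: "b \<in> S" "j b = i a" for b
    proof
      assume H: "\<forall>x\<in>S. (j(b := q)) x = (i(a := q)) (\<sigma> x)"
      have "q = (i(a := q)) (\<sigma> b)" using bspec[OF H b(1)] by simp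
      then have "\<sigma> b = a" using q(1) \<sigma>S[OF b(1)] by (auto split: if_splits)
      then have bb: "b = b0" using inj by simp
      have "j x = i (\<sigma> x)" if "x \<in> S" for x
      proof (cases "x = b")
        case True
        then show ?thesis using b(2) \<open>\<sigma> b = a\<close> by simp
      next
        case False
        then have "\<sigma> x \<noteq> a" using inj bb by simp
        then show ?thesis using bspec[OF H that] False by simp
      qed
      then show "b = b0 \<and> (\<forall>x\<in>S. j x = i (\<sigma> x))" using bb by blast
    next
      assume "b = b0 \<and> (\<forall>x\<in>S. j x = i (\<sigma> x))"
      then show "\<forall>x\<in>S. (j(b := q)) x = (i(a := q)) (\<sigma> x)" using inj by simp
    qed
    have "(\<Sum>b | b \<in> S \<and> j b = i a.
          if \<forall>x\<in>S. (j(b := q)) x = (i(a := q)) (\<sigma> x) then c \<sigma> else 0)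
        = (\<Sum>b | b \<in> S \<and> j b = i a. if b = b0 then if \<forall>x\<in>S. j x = i (\<sigma> x) then c \<sigma> else 0 else 0)"
      by (intro sum.cong refl) (use eq in simp)
    also have "\<dots> = (if b0 \<in> {b \<in> S. j b = i a} then if \<forall>x\<in>S. j x = i (\<sigma> x) then c \<sigma> else 0 else 0)"
      using S by (subst sum.delta) auto
    finally show ?thesis using b0 by auto
  qed
  show ?thesis unfolding permutation_sum_def
    by (subst sum.swap, intro sum.cong refl) (use * in simp)
qed

text \<open>An index tuple with a repeated value is reduced by \<open>rec\<close> to tuples with more distinct
  values, for which a fresh value \<open>q\<close> is available as long as there are at most \<open>CARD('b)\<close> indices.\<close>
lemma eq_permutation_sum:
  fixes m :: "('a \<Rightarrow> 'b :: finite) \<Rightarrow> ('a \<Rightarrow> 'b) \<Rightarrow> complex"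
  assumes S: "finite S" "card S \<le> CARD('b)"
    and unbalanced: "\<And>i j v. card {a \<in> S. i a = v} \<noteq> card {a \<in> S. j a = v} \<Longrightarrow> m i j = 0"
    and rec: "\<And>i j a q. a \<in> S \<Longrightarrow> q \<notin> i ` S \<Longrightarrow> q \<notin> j ` S \<Longrightarrow>
      m i j = (\<Sum>b | b \<in> S \<and> j b = i a. m (i(a := q)) (j(b := q)))"
    and inj: "\<And>i \<sigma>. inj_on i S \<Longrightarrow> \<sigma> permutes S \<Longrightarrow> m i (i \<circ> \<sigma>) = c \<sigma>"
    and cong: "\<And>i j j'. (\<And>a. a \<in> S \<Longrightarrow> j a = j' a) \<Longrightarrow> m i j = m i j'"
  shows "m i j = permutation_sum S c i j"
\<comment> \<open>The induction is on the number of repetitions in the row tuple.\<close>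
proof (induction "card S - card (i ` S)" arbitrary: i j rule: less_induct)
  case less
  have cnt: "count (image_mset f (mset_set S)) v = card {a \<in> S. f a = v}" for f :: "'a \<Rightarrow> 'b" and v
    using S(1) by (auto simp: count_image_mset' intro!: arg_cong[of _ _ card])
  show ?case
  proof (cases "\<forall>v. card {a \<in> S. i a = v} = card {a \<in> S. j a = v}")
    case False
    then obtain v where v: "card {a \<in> S. i a = v} \<noteq> card {a \<in> S. j a = v}" by blast
    \<comment> \<open>Both sides vanish: a compatible permutation would make every value equally
      frequent in \<open>i\<close> and \<open>j\<close>.\<close>
    have "\<not> (\<forall>a\<in>S. j a = i (\<sigma> a))" if "\<sigma> permutes S" for \<sigma>
    proof
      assume "\<forall>a\<in>S. j a = i (\<sigma> a)"
      then have "image_mset i (mset_set S) = image_mset j (mset_set S)"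
        using permutes_implies_image_mset_eq[OF that, of j i] by simp
      then show False using v cnt by metis
    qed
    then have "permutation_sum S c i j = 0"
      unfolding permutation_sum_def by (intro sum.neutral) auto
    then show ?thesis using unbalanced[OF v] by simp
  next
    case True
    then have "image_mset j (mset_set S) = image_mset i (mset_set S)"
      by (intro multiset_eqI) (simp add: cnt)
    then obtain p where p: "p permutes S" "\<forall>x\<in>S. j x = i (p x)"
      using image_mset_eq_implies_permutes[OF S(1)] by metis
    show ?thesis
    proof (cases "inj_on i S")
      case i: True
      have "m i j = c p" using inj[OF i p(1)] cong[of j "i \<circ> p" i] p(2) by simp
      \<comment> \<open>For injective \<open>i\<close> the permutation is determined by
        \<open>j\<close>, so a single term survives.\<close>
      moreover have "(\<forall>a\<in>S. j a = i (\<sigma> a)) \<longleftrightarrow> \<sigma> = p" if \<sigma>: "\<sigma> permutes S" for \<sigma>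
      proof
        assume H: "\<forall>a\<in>S. j a = i (\<sigma> a)"
        have "\<sigma> a = p a" for a
        proof (cases "a \<in> S")
          case True
          then have "i (\<sigma> a) = i (p a)" using H p(2) by simp
          then show ?thesis
            using inj_onD[OF i] permutes_in_image[OF \<sigma>] permutes_in_image[OF p(1)] True by blast
        next
          case False
          then show ?thesis using \<sigma> p(1) by (simp add: permutes_not_in)
        qed
        then show "\<sigma> = p" by blast
      qed (use p(2) in simp)
      then have "permutation_sum S c i j = (\<Sum>\<sigma> | \<sigma> permutes S. if \<sigma> = p then c p else 0)"
        unfolding permutation_sum_def by (intro sum.cong) auto
      then have "permutation_sum S c i j = c p"
        using p(1) finite_permutations[OF S(1)] by (simp add: sum.delta)
      ultimately show ?thesis by simp
    next
      case False
      then obtain a b where ab: "a \<in> S" "b \<in> S" "a \<noteq> b" "i a = i b" by (auto simp: inj_on_def)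
      have lt: "card (i ` S) < card S"
        using False S(1) card_image_le[of S i] eq_card_imp_inj_on[of S i] by linarith
      \<comment> \<open>A repeated value leaves fewer than \<open>card S \<le> CARD('b)\<close>
        values in use, hence a fresh one exists.\<close>
      have "i ` S \<noteq> UNIV" using lt S(2) by auto
      then obtain q where q: "q \<notin> i ` S" by blast
      have "j ` S \<subseteq> i ` S" using p permutes_in_image[OF p(1)] by auto
      then have q': "q \<notin> j ` S" using q by blast
      \<comment> \<open>The old value \<open>i a\<close> is still attained at \<open>b\<close>, so
        replacing it at \<open>a\<close> gains one distinct value.\<close>
      have "(i(a := q)) ` S = insert q (i ` S)"
      proof -
        have "i a \<in> i ` (S - {a})" using ab by (metis DiffI image_eqI singletonD)
        then have "i ` S = i ` (S - {a})" using ab(1) by (metis image_insert insert_Diff insert_absorb)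
        moreover have "(i(a := q)) ` S = insert q (i ` (S - {a}))"
          using ab(1) by (auto simp: image_iff)
        ultimately show ?thesis by simp
      qed
      then have "card S - card ((i(a := q)) ` S) < card S - card (i ` S)"
        using q lt S(1) by simp
      note IH = less(1)[OF this]
      have "m i j = (\<Sum>b | b \<in> S \<and> j b = i a. permutation_sum S c (i(a := q)) (j(b := q)))"
        unfolding rec[OF ab(1) q q'] IH ..
      then show ?thesis using permutation_sum_fresh[OF S(1) ab(1) q q'] by simp
    qed
  qed
qed

section \<open>Differentiation of the rotation invariance\<close>

lemma sum_PiE_delta:
  assumes "finite T"
  shows "(\<Sum>p\<in>PiE T (\<lambda>_. UNIV :: 'b :: finite set). of_bool (\<forall>b\<in>T. i b = p b) * h p)
    = (h (restrict i T) :: 'c :: semiring_1)"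
proof -
  have "(\<Sum>p\<in>PiE T (\<lambda>_. UNIV :: 'b set). of_bool (\<forall>b\<in>T. i b = p b) * h p)
      = (\<Sum>p\<in>PiE T (\<lambda>_. UNIV). if p = restrict i T then h (restrict i T) else 0)"
  proof (intro sum.cong refl)
    fix p :: "'a \<Rightarrow> 'b" assume "p \<in> PiE T (\<lambda>_. UNIV)"
    then have "(\<forall>b\<in>T. i b = p b) \<longleftrightarrow> p = restrict i T"
      by (auto simp: PiE_def extensional_def fun_eq_iff)
    then show "of_bool (\<forall>b\<in>T. i b = p b) * h p
      = (if p = restrict i T then h (restrict i T) else 0)" by simp
  qed
  then show ?thesis using assms by (simp add: finite_PiE)
qed

text \<open>The inner sum over \<open>a\<close> is what the product rule gives for the derivative of
  a product of matrix entries at the identity: one index moves by \<open>X\<close> and all others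
  stay. Against \<open>g\<close>, this leaves the tuples that differ from \<open>i\<close> in one
  place.\<close>

lemma sum_PiE_single_change:
  fixes X :: "'b :: finite \<Rightarrow> 'b \<Rightarrow> complex"
  assumes S: "finite S"
    and cong: "\<And>p p'. (\<And>a. a \<in> S \<Longrightarrow> p a = p' a) \<Longrightarrow> g p = g p'"
  shows "(\<Sum>p\<in>PiE S (\<lambda>_. UNIV).
      (\<Sum>a\<in>S. X (i a) (p a) * of_bool (\<forall>b\<in>S - {a}. i b = p b)) * g p)
    = (\<Sum>a\<in>S. \<Sum>u\<in>UNIV. X (i a) u * g (i(a := u)))"
proof -
  have "(\<Sum>p\<in>PiE S (\<lambda>_. UNIV). X (i a) (p a) * of_bool (\<forall>b\<in>S - {a}. i b = p b) * g p)
      = (\<Sum>u\<in>UNIV. X (i a) u * g (i(a := u)))" if a: "a \<in> S" for a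
  proof -
    have "(\<Sum>p\<in>PiE S (\<lambda>_. UNIV). X (i a) (p a) * of_bool (\<forall>b\<in>S - {a}. i b = p b) * g p)
        = (\<Sum>p\<in>PiE (insert a (S - {a})) (\<lambda>_. UNIV).
            X (i a) (p a) * of_bool (\<forall>b\<in>S - {a}. i b = p b) * g p)"
      using a by (simp add: insert_absorb)
    also have "\<dots> = (\<Sum>u\<in>UNIV. \<Sum>p\<in>PiE (S - {a}) (\<lambda>_. UNIV).
        of_bool (\<forall>b\<in>S - {a}. i b = p b) * (X (i a) u * g (p(a := u))))"
      by (subst sum_PiE_insert) (auto intro!: sum.cong simp: mult_ac)
    also have "\<dots> = (\<Sum>u\<in>UNIV. X (i a) u * g ((restrict i (S - {a}))(a := u)))"
      using S by (subst sum_PiE_delta) auto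
    also have "\<dots> = (\<Sum>u\<in>UNIV. X (i a) u * g (i(a := u)))"
      by (intro sum.cong refl arg_cong2[where f = "(*)"] cong) auto
    finally show ?thesis .
  qed
  then show ?thesis
    unfolding sum_distrib_right by (subst sum.swap) simp
qed

lemma prod_of_bool_Ball:
  "finite T \<Longrightarrow> (\<Prod>a\<in>T. of_bool (P a)) = (of_bool (\<forall>a\<in>T. P a) :: 'a :: comm_semiring_1)"
  by (induction T rule: finite_induct) auto

text \<open>The moment on the left of the invariance does not depend on \<open>\<theta>\<close>, so
  the derivative of the right side at 0 vanishes. There the product rule leaves the terms in which a
  single row or column index changes.\<close>

lemma infinitesimal_invariance:
  fixes R :: "real \<Rightarrow> 'b :: finite \<Rightarrow> 'b \<Rightarrow> real"
  assumes S: "finite S"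
    and invariant: "\<And>\<theta>. m i j = (\<Sum>p\<in>PiE S (\<lambda>_. UNIV). \<Sum>r\<in>PiE S (\<lambda>_. UNIV).
      of_real ((\<Prod>a\<in>S. R \<theta> (i a) (p a)) * (\<Prod>a\<in>S. R \<theta> (j a) (r a))) * m p r)"
    and R0: "\<And>x y. R 0 x y = of_bool (x = y)"
    and R': "\<And>x y. ((\<lambda>\<theta>. R \<theta> x y) has_real_derivative X x y) (at 0)"
    and cong: "\<And>i i' j j'. (\<And>a. a \<in> S \<Longrightarrow> i a = i' a) \<Longrightarrow> (\<And>a. a \<in> S \<Longrightarrow> j a = j' a) \<Longrightarrow>
      m i j = (m i' j' :: complex)"
  shows "(\<Sum>a\<in>S. \<Sum>u\<in>UNIV. of_real (X (i a) u) * m (i(a := u)) j)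
    + (\<Sum>a\<in>S. \<Sum>u\<in>UNIV. of_real (X (j a) u) * m i (j(a := u))) = 0"
proof -
  define F where "F i p \<theta> = (\<Prod>a\<in>S. R \<theta> (i a) (p a))" for i p :: "'a \<Rightarrow> 'b" and \<theta>
  define D where "D i p = (\<Sum>a\<in>S. X (i a) (p a) * of_bool (\<forall>b\<in>S - {a}. i b = p b))"
    for i p :: "'a \<Rightarrow> 'b"
  have ob: "of_real (of_bool P) = (of_bool P :: complex)" for P by (cases P) auto
  have F0: "F i p 0 = of_bool (\<forall>b\<in>S. i b = p b)" for i p
    unfolding F_def R0 using S by (rule prod_of_bool_Ball)
  have F': "(F i p has_real_derivative D i p) (at 0)" for i p
  proof -
    have "((\<lambda>\<theta>. \<Prod>a\<in>S. R \<theta> (i a) (p a)) has_derivative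
        (\<lambda>y. \<Sum>a\<in>S. X (i a) (p a) * y * (\<Prod>b\<in>S - {a}. R 0 (i b) (p b)))) (at 0)"
      using R' by (intro has_derivative_prod) (simp add: has_field_derivative_def)
    moreover have "(\<lambda>y. \<Sum>a\<in>S. X (i a) (p a) * y * (\<Prod>b\<in>S - {a}. R 0 (i b) (p b))) = (*) (D i p)"
      unfolding D_def R0 sum_distrib_right using S
      by (intro ext sum.cong refl) (simp add: prod_of_bool_Ball)
    ultimately show ?thesis unfolding has_field_derivative_def F_def[abs_def] by simp
  qed
  have der: "((\<lambda>\<theta>. \<Sum>p\<in>PiE S (\<lambda>_. UNIV). \<Sum>r\<in>PiE S (\<lambda>_. UNIV). of_real (F i p \<theta> * F j r \<theta>) * m p r)
      has_vector_derivative (\<Sum>p\<in>PiE S (\<lambda>_. UNIV). \<Sum>r\<in>PiE S (\<lambda>_. UNIV).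
        of_real (D i p * F j r 0 + D j r * F i p 0) * m p r)) (at 0)"
    by (intro has_vector_derivative_sum has_vector_derivative_mult_left
        has_vector_derivative_of_real DERIV_mult F')
  have const: "(\<lambda>\<theta>. \<Sum>p\<in>PiE S (\<lambda>_. UNIV). \<Sum>r\<in>PiE S (\<lambda>_. UNIV).
      of_real (F i p \<theta> * F j r \<theta>) * m p r) = (\<lambda>_. m i j)"
    using invariant[symmetric] unfolding F_def by (rule ext)
  have "(\<Sum>p\<in>PiE S (\<lambda>_. UNIV). \<Sum>r\<in>PiE S (\<lambda>_. UNIV).
        of_real (D i p * F j r 0 + D j r * F i p 0) * m p r) = 0"
    using vector_derivative_unique_at[OF der[unfolded const] has_vector_derivative_const] .
  moreover have "(\<Sum>p\<in>PiE S (\<lambda>_. UNIV). \<Sum>r\<in>PiE S (\<lambda>_. UNIV).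
        of_real (D i p * F j r 0 + D j r * F i p 0) * m p r)
      = (\<Sum>p\<in>PiE S (\<lambda>_. UNIV). of_real (D i p) * (\<Sum>r\<in>PiE S (\<lambda>_. UNIV). of_bool (\<forall>b\<in>S. j b = r b) * m p r))
      + (\<Sum>r\<in>PiE S (\<lambda>_. UNIV). of_real (D j r) * (\<Sum>p\<in>PiE S (\<lambda>_. UNIV). of_bool (\<forall>b\<in>S. i b = p b) * m p r))"
    (is "_ = ?P + ?R")
  proof -
    let ?E = "PiE S (\<lambda>_. UNIV :: 'b set)"
    have "(\<Sum>p\<in>?E. \<Sum>r\<in>?E. of_real (D i p * F j r 0 + D j r * F i p 0) * m p r)
        = (\<Sum>p\<in>?E. \<Sum>r\<in>?E. of_real (D i p) * (of_bool (\<forall>b\<in>S. j b = r b) * m p r))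
        + (\<Sum>p\<in>?E. \<Sum>r\<in>?E. of_real (D j r) * (of_bool (\<forall>b\<in>S. i b = p b) * m p r))"
      unfolding F0 sum.distrib[symmetric] by (intro sum.cong refl) (simp add: algebra_simps)
    also have "\<dots> = ?P + ?R"
      by (subst (2) sum.swap) (simp only: sum_distrib_left)
    finally show ?thesis .
  qed
  moreover have "(\<Sum>r\<in>PiE S (\<lambda>_. UNIV). of_bool (\<forall>b\<in>S. j b = r b) * m p r) = m p j" for p
    using sum_PiE_delta[OF S, of j "m p"] cong[of p p "restrict j S" j] by simp
  moreover have "(\<Sum>p\<in>PiE S (\<lambda>_. UNIV). of_bool (\<forall>b\<in>S. i b = p b) * m p r) = m i r" for r
    using sum_PiE_delta[OF S, of i "\<lambda>p. m p r"] cong[of "restrict i S" i r r] by simp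
  moreover have "(\<Sum>p\<in>PiE S (\<lambda>_. UNIV). of_real (D i p) * m p j)
      = (\<Sum>a\<in>S. \<Sum>u\<in>UNIV. of_real (X (i a) u) * m (i(a := u)) j)"
    unfolding D_def of_real_sum of_real_mult ob
    by (rule sum_PiE_single_change[OF S, where g = "\<lambda>p. m p j" and X = "\<lambda>x u. of_real (X x u)" and i = i])
      (rule cong, auto)
  moreover have "(\<Sum>r\<in>PiE S (\<lambda>_. UNIV). of_real (D j r) * m i r)
      = (\<Sum>a\<in>S. \<Sum>u\<in>UNIV. of_real (X (j a) u) * m i (j(a := u)))"
    unfolding D_def of_real_sum of_real_mult ob
    by (rule sum_PiE_single_change[OF S, where g = "\<lambda>p. m i p" and X = "\<lambda>x u. of_real (X x u)" and i = j])
      (rule cong, auto)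
  ultimately show ?thesis by simp
qed

text \<open>These matrices are real, so the conjugation in the adjoint has no effect on their
  entries, and row and column indices transform with the same coefficients.\<close>

definition plane_rotation :: "'b \<Rightarrow> 'b \<Rightarrow> real \<Rightarrow> 'b \<Rightarrow> 'b \<Rightarrow> real" where
  "plane_rotation q v \<theta> x y =
    (if x = q \<and> y = v then sin \<theta> else if x = v \<and> y = q then - sin \<theta>
     else if x = y then if x = q \<or> x = v then cos \<theta> else 1 else 0)"

text \<open>The generator of the rotation is \<open>E\<^bsub>qv\<^esub> - E\<^bsub>vq\<^esub>\<close>. In its action on the moment with
  row indices \<open>i(a := q)\<close> and column indices \<open>j\<close>, all terms that are not of the form required here
  are unbalanced.\<close>
lemma rotation_invariant_rec:
  fixes m :: "('a \<Rightarrow> 'b :: finite) \<Rightarrow> ('a \<Rightarrow> 'b) \<Rightarrow> complex"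
  assumes S: "finite S"
    and unbalanced: "\<And>i j v. card {a \<in> S. i a = v} \<noteq> card {a \<in> S. j a = v} \<Longrightarrow> m i j = 0"
    and invariant: "\<And>i j q v \<theta>. q \<noteq> v \<Longrightarrow> m i j = (\<Sum>p\<in>PiE S (\<lambda>_. UNIV). \<Sum>r\<in>PiE S (\<lambda>_. UNIV).
      of_real ((\<Prod>a\<in>S. plane_rotation q v \<theta> (i a) (p a))
        * (\<Prod>a\<in>S. plane_rotation q v \<theta> (j a) (r a))) * m p r)"
    and cong: "\<And>i i' j j'. (\<And>a. a \<in> S \<Longrightarrow> i a = i' a) \<Longrightarrow> (\<And>a. a \<in> S \<Longrightarrow> j a = j' a) \<Longrightarrow>
      m i j = m i' j'"
    and a: "a \<in> S" and q: "q \<notin> i ` S" "q \<notin> j ` S"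
  shows "m i j = (\<Sum>b | b \<in> S \<and> j b = i a. m (i(a := q)) (j(b := q)))"
proof -
  define v where "v = i a"
  have qv: "q \<noteq> v" using q(1) a by (auto simp: v_def)
  define X :: "'b \<Rightarrow> 'b \<Rightarrow> real" where
    "X x y = (if x = q \<and> y = v then 1 else if x = v \<and> y = q then - 1 else 0)" for x y
  have R': "((\<lambda>\<theta>. plane_rotation q v \<theta> x y) has_real_derivative X x y) (at 0)" for x y
    using qv unfolding plane_rotation_def X_def
    by (cases "x = q"; cases "x = v"; cases "y = q"; cases "y = v"; cases "x = y")
      (auto intro!: derivative_eq_intros)
  have R0: "plane_rotation q v 0 x y = of_bool (x = y)" for x y
    using qv by (auto simp: plane_rotation_def)
  have X: "(\<Sum>u\<in>UNIV. of_real (X x u) * f u) = (if x = q then f v else if x = v then - f q else 0)"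
    for x and f :: "'b \<Rightarrow> complex"
  proof -
    have "of_real (X x u) * f u = (if u = v then if x = q then f v else 0 else 0)
        + (if u = q then if x = v then - f q else 0 else 0)" for u
      using qv by (auto simp: X_def)
    then show ?thesis using qv by (simp add: sum.distrib)
  qed
  \<comment> \<open>The invariance is differentiated at the tuple with \<open>q\<close> already
    placed at \<open>a\<close>; moving this \<open>q\<close> back to \<open>v\<close> restores
    \<open>i\<close> and produces the term \<open>m i j\<close>.\<close>
  let ?i = "i(a := q)"
  have "(\<Sum>b\<in>S. if ?i b = q then m (?i(b := v)) j else if ?i b = v then - m (?i(b := q)) j else 0)
      + (\<Sum>b\<in>S. if j b = q then m ?i (j(b := v)) else if j b = v then - m ?i (j(b := q)) else 0) = 0"
    using infinitesimal_invariance[OF S invariant[OF qv] R0 R' cong, of ?i j] unfolding X .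
  moreover have "(\<Sum>b\<in>S. if ?i b = q then m (?i(b := v)) j else if ?i b = v then - m (?i(b := q)) j else 0)
      = (\<Sum>b\<in>S. if b = a then m i j else 0)"
  proof (intro sum.cong refl)
    fix b assume b: "b \<in> S"
    \<comment> \<open>Here \<open>q\<close> occurs among the row indices but not among the column
      indices.\<close>
    have "m (?i(b := q)) j = 0"
    proof (rule unbalanced)
      have "{x \<in> S. (?i(b := q)) x = q} \<noteq> {}" using b by auto
      then have "card {x \<in> S. (?i(b := q)) x = q} \<noteq> 0" using S by simp
      moreover have "{x \<in> S. j x = q} = {}" using q(2) by auto
      ultimately show "card {x \<in> S. (?i(b := q)) x = q} \<noteq> card {x \<in> S. j x = q}"
        by (metis card.empty)
    qed
    moreover have "?i b = q \<longleftrightarrow> b = a" using q(1) b by auto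
    moreover have "?i(a := v) = i" by (simp add: v_def)
    ultimately show "(if ?i b = q then m (?i(b := v)) j else if ?i b = v then - m (?i(b := q)) j else 0)
      = (if b = a then m i j else 0)" by auto
  qed
  \<comment> \<open>As \<open>q\<close> is no column index, only the replacements of
    \<open>v\<close> by \<open>q\<close> remain, with the negative sign of the generator.\<close>
  moreover have "(\<Sum>b\<in>S. if j b = q then m ?i (j(b := v)) else if j b = v then - m ?i (j(b := q)) else 0)
      = - (\<Sum>b | b \<in> S \<and> j b = v. m ?i (j(b := q)))"
    unfolding sum_negf[symmetric]
    by (subst Collect_conj_eq, subst Collect_mem_eq, subst sum.inter_restrict[OF S])
      (use q(2) in \<open>auto intro!: sum.cong\<close>)
  ultimately show ?thesis using S a by (simp add: v_def)
qed

section \<open>Unitary conjugation and exponentially bounded functions\<close>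

lemma unitary_conjugation_nth:
  "(U ** M ** dagger U) $ x $ y = (\<Sum>p\<in>UNIV. \<Sum>r\<in>UNIV. U $ x $ p * M $ p $ r * cnj (U $ y $ r))"
  unfolding matrix_matrix_mult_def dagger_def by (simp add: sum_distrib_right) (rule sum.swap)

lemma linear_unitary_conjugation: "linear (\<lambda>M :: complex^'n^'n. U ** M ** dagger U)"
  by (rule linearI)
    (simp_all add: vec_eq_iff unitary_conjugation_nth algebra_simps sum.distrib scaleR_sum_right)

lemma dagger_dagger [simp]: "dagger (dagger M) = M"
  by (simp add: dagger_def vec_eq_iff)

lemma dagger_mult: "dagger (A ** B) = dagger B ** dagger A"
  by (simp add: dagger_def matrix_matrix_mult_def vec_eq_iff mult.commute)

lemma linear_dagger: "linear (dagger :: complex^'n^'n \<Rightarrow> _)"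
  by (rule linearI) (simp_all add: dagger_def vec_eq_iff)

lemma hermitian_unitary_conjugation:
  "M \<in> hermitian_mats \<Longrightarrow> U ** M ** dagger U \<in> hermitian_mats"
  by (simp add: hermitian_mats_def dagger_mult matrix_mul_assoc)

lemma mat_pow_unitary_conjugation:
  assumes "unitary_mat U"
  shows "mat_pow (U ** M ** dagger U) d = U ** mat_pow M d ** dagger U"
proof (induction d)
  case 0
  then show ?case using assms by (simp add: mat_pow_def unitary_mat_def)
next
  case (Suc d)
  have "mat_pow (U ** M ** dagger U) (Suc d) = U ** M ** (dagger U ** U) ** mat_pow M d ** dagger U"
    using Suc by (simp add: mat_pow_def matrix_mul_assoc)
  also have "\<dots> = U ** M ** mat 1 ** mat_pow M d ** dagger U"
    using assms by (simp only: unitary_mat_def)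
  also have "\<dots> = U ** mat_pow M (Suc d) ** dagger U"
    by (simp add: mat_pow_def matrix_mul_assoc)
  finally show ?case .
qed

lemma trace_unitary_conjugation:
  assumes "unitary_mat U"
  shows "trace (U ** M ** dagger U) = trace M"
  using assms trace_mul_sym[of "U ** M" "dagger U"]
  by (simp add: unitary_mat_def matrix_mul_assoc)

lemma trace_mult_sum: "trace (M ** A) = (\<Sum>x\<in>UNIV. \<Sum>y\<in>UNIV. M $ x $ y * A $ y $ x)"
  by (simp add: trace_def matrix_matrix_mult_def)

text \<open>For Hermitian matrices the trace is its own conjugate, hence real, and its real part is
  the entrywise inner product.\<close>

lemma trace_mult_hermitian:
  assumes "M \<in> hermitian_mats" "A \<in> hermitian_mats"
  shows "trace (M ** A) = of_real (M \<bullet> A)"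
proof -
  have A: "A $ y $ x = cnj (A $ x $ y)" and M: "M $ y $ x = cnj (M $ x $ y)" for x y
    using assms by (auto simp: hermitian_mats_def dagger_def vec_eq_iff)
  have "Re (trace (M ** A)) = M \<bullet> A"
    unfolding trace_mult_sum inner_vec_def
    by (simp, intro sum.cong refl) (subst A, simp add: inner_complex_def)
  moreover have "cnj (trace (M ** A)) = trace (M ** A)"
    unfolding trace_mult_sum
    by (subst (2) sum.swap) (simp add: A[symmetric] M[symmetric])
  ultimately show ?thesis by (metis Reals_cnj_iff of_real_Re)
qed

lemma inner_dagger: "dagger M \<bullet> dagger A = M \<bullet> A"
  unfolding inner_vec_def dagger_def by (simp add: inner_complex_def) (rule sum.swap)

section \<open>Diagonal phases and permutation matrices\<close>

definition diagonal_phase :: "'n \<Rightarrow> complex \<Rightarrow> complex^'n^'n" where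
  "diagonal_phase v z = (\<chi> x y. if x = y then if x = v then z else 1 else 0)"

lemma sum_delta_delta_cnj:
  "(\<Sum>p\<in>UNIV. \<Sum>r\<in>UNIV. (if x = p then a p else 0) * m p r * cnj (if y = r then b r else 0))
    = a x * m (x :: 'a :: finite) (y :: 'b :: finite) * cnj (b y)"
proof -
  have "(\<Sum>p\<in>UNIV. \<Sum>r\<in>UNIV. (if x = p then a p else 0) * m p r * cnj (if y = r then b r else 0))
      = (\<Sum>p\<in>UNIV. \<Sum>r\<in>UNIV. if y = r then if x = p then a p * m p r * cnj (b r) else 0 else 0)"
    by (intro sum.cong refl) auto
  then show ?thesis by simp
qed

lemma diagonal_phase_conjugation:
  "(diagonal_phase v z ** M ** dagger (diagonal_phase v z)) $ x $ y
    = (if x = v then z else 1) * M $ x $ y * cnj (if y = v then z else 1)"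
  unfolding unitary_conjugation_nth diagonal_phase_def vec_lambda_beta by (rule trans[OF sum_delta_delta_cnj]) simp

lemma unitary_diagonal_phase:
  assumes "z * cnj z = 1"
  shows "unitary_mat (diagonal_phase v z)"
proof -
  have "dagger (diagonal_phase v z) = diagonal_phase v (cnj z)"
    by (simp add: diagonal_phase_def dagger_def vec_eq_iff)
  moreover have "diagonal_phase v u ** diagonal_phase v u' = diagonal_phase v (u * u')" for u u'
  proof -
    have "(diagonal_phase v u ** diagonal_phase v u') $ x $ y
        = (\<Sum>p\<in>UNIV. diagonal_phase v u $ x $ p * diagonal_phase v u' $ p $ y)" for x y
      by (simp add: matrix_matrix_mult_def)
    also have "\<dots> x y = (\<Sum>p\<in>UNIV. if x = p
        then diagonal_phase v u $ x $ x * diagonal_phase v u' $ x $ y else 0)" for x y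
      by (intro sum.cong refl) (simp add: diagonal_phase_def)
    finally have "(diagonal_phase v u ** diagonal_phase v u') $ x $ y
        = diagonal_phase v u $ x $ x * diagonal_phase v u' $ x $ y" for x y by simp
    then show ?thesis unfolding vec_eq_iff by (auto simp: diagonal_phase_def)
  qed
  moreover have "diagonal_phase v 1 = mat 1"
    by (simp add: diagonal_phase_def mat_def vec_eq_iff)
  ultimately show ?thesis using assms by (simp add: unitary_mat_def mult.commute)
qed

definition permutation_matrix :: "('n \<Rightarrow> 'n) \<Rightarrow> complex^'n^'n" where
  "permutation_matrix \<tau> = (\<chi> x y. if \<tau> x = y then 1 else 0)"

lemma permutation_matrix_conjugation:
  "(permutation_matrix \<tau> ** M ** dagger (permutation_matrix \<tau>)) $ x $ y = M $ \<tau> x $ \<tau> y"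
  unfolding unitary_conjugation_nth permutation_matrix_def vec_lambda_beta
  by (rule trans[OF sum_delta_delta_cnj]) simp

lemma unitary_permutation_matrix:
  assumes "bij \<tau>"
  shows "unitary_mat (permutation_matrix \<tau>)"
proof -
  have "permutation_matrix \<tau> ** mat 1 ** dagger (permutation_matrix \<tau>) = mat 1"
    unfolding vec_eq_iff permutation_matrix_conjugation
    using assms by (auto simp: mat_def bij_def inj_eq)
  then have "permutation_matrix \<tau> ** dagger (permutation_matrix \<tau>) = mat 1" by simp
  then show ?thesis unfolding unitary_mat_def using matrix_left_right_inverse by metis
qed

text \<open>A class of test functions closed under sums and products that contains the matrix
  entries and all \<open>ext_weight A\<close>. Continuity gives measurability, and the growth bound
  gives integrability once all exponential moments are finite.\<close>

definition exp_bounded :: "(complex^'n^'n \<Rightarrow> complex) \<Rightarrow> bool" where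
  "exp_bounded f \<longleftrightarrow> continuous_on UNIV f \<and> (\<exists>C c. \<forall>M. norm (f M) \<le> C * exp (c * norm M))"

lemma exp_boundedE:
  assumes "exp_bounded f"
  obtains C c where "0 \<le> C" "0 \<le> c" "\<And>M. norm (f M) \<le> C * exp (c * norm M)"
proof -
  obtain C c where *: "\<And>M. norm (f M) \<le> C * exp (c * norm M)"
    using assms by (auto simp: exp_bounded_def)
  have "norm (f M) \<le> \<bar>C\<bar> * exp (\<bar>c\<bar> * norm M)" for M
    by (rule order_trans[OF *]) (intro mult_mono; simp add: mult_right_mono)
  then show ?thesis using that[of "\<bar>C\<bar>" "\<bar>c\<bar>"] by simp
qed

lemma exp_bounded_const [simp]: "exp_bounded (\<lambda>_ :: complex^'n^'n. a)"
proof -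
  have "norm a \<le> norm a * exp (0 * norm M)" for M :: "complex^'n^'n" by simp
  then show ?thesis unfolding exp_bounded_def by (intro conjI continuous_on_const) blast
qed

lemma norm_nth_nth_le: "norm (M $ x $ y) \<le> norm M"
  by (rule order_trans[OF Finite_Cartesian_Product.norm_nth_le Finite_Cartesian_Product.norm_nth_le])

lemma exp_bounded_nth [simp]: "exp_bounded (\<lambda>M :: complex^'n^'n. M $ x $ y)"
proof -
  have "norm (M $ x $ y) \<le> 1 * exp (1 * norm M)" for M :: "complex^'n^'n"
  proof -
    note norm_nth_nth_le
    also have "norm M \<le> exp (norm M)" using exp_ge_add_one_self[of "norm M"] by linarith
    finally show ?thesis by simp
  qed
  then show ?thesis
    unfolding exp_bounded_def by (intro conjI continuous_intros) blast
qed

lemma exp_bounded_mult [intro]: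
  assumes "exp_bounded f" "exp_bounded g"
  shows "exp_bounded (\<lambda>M. f M * g M)"
proof -
  obtain C c where f: "0 \<le> C" "\<And>M. norm (f M) \<le> C * exp (c * norm M)"
    using exp_boundedE[OF assms(1)] by metis
  obtain D d where g: "0 \<le> D" "\<And>M. norm (g M) \<le> D * exp (d * norm M)"
    using exp_boundedE[OF assms(2)] by metis
  have "norm (f M * g M) \<le> (C * D) * exp ((c + d) * norm M)" for M
  proof -
    have "norm (f M * g M) \<le> (C * exp (c * norm M)) * (D * exp (d * norm M))"
      unfolding norm_mult using f g by (intro mult_mono) auto
    then show ?thesis by (simp add: exp_add algebra_simps)
  qed
  then show ?thesis using assms unfolding exp_bounded_def by (auto intro!: continuous_intros)
qed

lemma exp_bounded_add [intro]:
  assumes "exp_bounded f" "exp_bounded g"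
  shows "exp_bounded (\<lambda>M. f M + g M)"
proof -
  obtain C c where f: "0 \<le> C" "0 \<le> c" "\<And>M. norm (f M) \<le> C * exp (c * norm M)"
    using exp_boundedE[OF assms(1)] by metis
  obtain D d where g: "0 \<le> D" "0 \<le> d" "\<And>M. norm (g M) \<le> D * exp (d * norm M)"
    using exp_boundedE[OF assms(2)] by metis
  have "norm (f M + g M) \<le> (C + D) * exp ((c + d) * norm M)" for M
  proof -
    have "norm (f M + g M) \<le> C * exp (c * norm M) + D * exp (d * norm M)"
      using norm_triangle_ineq[of "f M" "g M"] f(3)[of M] g(3)[of M] by linarith
    also have "\<dots> \<le> C * exp ((c + d) * norm M) + D * exp ((c + d) * norm M)"
      using f g by (intro add_mono mult_left_mono) (auto simp: mult_right_mono)
    finally show ?thesis by (simp add: algebra_simps)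
  qed
  then show ?thesis using assms unfolding exp_bounded_def by (auto intro!: continuous_intros)
qed

lemma exp_bounded_sum [intro]:
  "(\<And>x. x \<in> A \<Longrightarrow> exp_bounded (f x)) \<Longrightarrow> exp_bounded (\<lambda>M. \<Sum>x\<in>A. f x M)"
  by (induction A rule: infinite_finite_induct) auto

lemma exp_bounded_prod [intro]:
  "(\<And>x. x \<in> A \<Longrightarrow> exp_bounded (f x)) \<Longrightarrow> exp_bounded (\<lambda>M. \<Prod>x\<in>A. f x M)"
  by (induction A rule: infinite_finite_induct) auto

lemma exp_bounded_power [intro]: "exp_bounded f \<Longrightarrow> exp_bounded (\<lambda>M. f M ^ n)"
  by (induction n) auto

lemma exp_bounded_trace_mult [intro]: "exp_bounded (\<lambda>M. trace (M ** (A :: complex^'n^'n)))"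
  unfolding trace_mult_sum by (intro exp_bounded_sum exp_bounded_mult) auto

lemma norm_trace_mult_le:
  fixes M A :: "complex^'n^'n"
  shows "norm (trace (M ** A)) \<le> (\<Sum>x\<in>UNIV. \<Sum>y\<in>UNIV. norm (A $ y $ x)) * norm M"
proof -
  have "norm (trace (M ** A)) \<le> (\<Sum>x\<in>UNIV. \<Sum>y\<in>UNIV. norm (M $ x $ y * A $ y $ x))"
    unfolding trace_mult_sum by (intro order_trans[OF norm_sum] sum_mono norm_sum)
  also have "\<dots> \<le> (\<Sum>x\<in>UNIV. \<Sum>y\<in>UNIV. norm (A $ y $ x) * norm M)"
    unfolding norm_mult mult.commute[of "norm (M $ _ $ _)"]
    by (intro sum_mono mult_left_mono norm_nth_nth_le) auto
  finally show ?thesis by (simp add: sum_distrib_right)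
qed

lemma exp_bounded_ext_weight [intro]:
  fixes A :: "complex^'n^'n"
  shows "exp_bounded (ext_weight A)"
proof -
  let ?c = "real CARD('n) * (\<Sum>x\<in>UNIV. \<Sum>y\<in>UNIV. norm (A $ y $ x))"
  have "norm (ext_weight A M) \<le> 1 * exp (?c * norm M)" for M
  proof -
    have "norm (ext_weight A M) \<le> exp (norm (of_nat CARD('n) * trace (M ** A)))"
      unfolding ext_weight_def by (rule norm_exp)
    also have "\<dots> \<le> exp (?c * norm M)"
      using norm_trace_mult_le[of M A] by (simp add: norm_mult mult.assoc mult_left_mono)
    finally show ?thesis by simp
  qed
  moreover have "continuous_on UNIV (\<lambda>M. trace (M ** A))"
    using exp_bounded_trace_mult[of A] by (simp add: exp_bounded_def)
  then have "continuous_on UNIV (ext_weight A)"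
    unfolding ext_weight_def by (intro continuous_intros)
  ultimately show ?thesis unfolding exp_bounded_def by blast
qed

lemma exp_bounded_mat_pow: "exp_bounded (\<lambda>M. mat_pow M d $ x $ y)"
proof (induction d arbitrary: x)
  case 0
  then show ?case by (simp add: mat_pow_def)
next
  case (Suc d)
  have "mat_pow M (Suc d) $ x $ y = (\<Sum>z\<in>UNIV. M $ x $ z * mat_pow M d $ z $ y)" for M
    by (simp add: mat_pow_def matrix_matrix_mult_def)
  then show ?case using Suc by (auto intro!: exp_bounded_sum exp_bounded_mult)
qed

lemma exp_bounded_trace_mat_pow [intro]: "exp_bounded (\<lambda>M. trace (mat_pow M d))"
  unfolding trace_def by (intro exp_bounded_sum exp_bounded_mat_pow)

section \<open>Expansion for an invariant weight\<close>

text \<open>The norm is at most \<open>DIM('a)\<close> times the largest absolute coordinate, and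
  the exponential of an absolute value is at most the sum of the exponentials with both
  signs.\<close>

lemma exp_norm_le_sum_exp:
  fixes x :: "'a :: euclidean_space"
  assumes "0 \<le> c"
  shows "exp (c * norm x) \<le> (\<Sum>b\<in>Basis. exp (c * DIM('a) * (x \<bullet> b)) + exp (- (c * DIM('a) * (x \<bullet> b))))"
proof -
  define m where "m = Max ((\<lambda>b. \<bar>x \<bullet> b\<bar>) ` Basis)"
  have "m \<in> (\<lambda>b. \<bar>x \<bullet> b\<bar>) ` Basis" unfolding m_def by (intro Max_in) auto
  then obtain b0 where b0: "b0 \<in> Basis" "m = \<bar>x \<bullet> b0\<bar>" by blast
  have "\<bar>x \<bullet> b\<bar> \<le> m" if "b \<in> Basis" for b unfolding m_def using that by (intro Max_ge) auto
  then have "(\<Sum>b\<in>Basis. \<bar>x \<bullet> b\<bar>) \<le> DIM('a) * m"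
    using sum_bounded_above[of Basis "\<lambda>b. \<bar>x \<bullet> b\<bar>" m] by simp
  then have "norm x \<le> DIM('a) * m" using norm_le_l1[of x] by linarith
  then have "c * norm x \<le> \<bar>c * DIM('a) * (x \<bullet> b0)\<bar>"
    using assms b0(2) by (simp add: abs_mult mult.assoc mult_left_mono)
  then have "exp (c * norm x) \<le> exp \<bar>c * DIM('a) * (x \<bullet> b0)\<bar>" by simp
  also have "\<dots> \<le> exp (c * DIM('a) * (x \<bullet> b0)) + exp (- (c * DIM('a) * (x \<bullet> b0)))"
    by (cases "0 \<le> c * DIM('a) * (x \<bullet> b0)") (simp_all add: abs_if)
  also have "\<dots> \<le> (\<Sum>b\<in>Basis. exp (c * DIM('a) * (x \<bullet> b)) + exp (- (c * DIM('a) * (x \<bullet> b))))"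
    by (rule member_le_sum[OF b0(1), of "\<lambda>b. exp (c * DIM('a) * (x \<bullet> b)) + exp (- (c * DIM('a) * (x \<bullet> b)))"])
      (auto intro: add_nonneg_nonneg)
  finally show ?thesis .
qed

text \<open>The complements of the two images have the same finite cardinality, so any bijection
  between them completes the map. It serves to realise a relabelling of distinct indices by a
  permutation matrix.\<close>

lemma bij_extending_injections:
  fixes i i' :: "'a \<Rightarrow> 'n :: finite"
  assumes "inj_on i S" "inj_on i' S"
  obtains \<tau> where "bij \<tau>" "\<And>a. a \<in> S \<Longrightarrow> \<tau> (i a) = i' a"
proof -
  have 1: "bij_betw (i' \<circ> the_inv_into S i) (i ` S) (i' ` S)"
    using assms by (intro bij_betw_trans[OF bij_betw_the_inv_into inj_on_imp_bij_betw])
      (auto simp: bij_betw_def)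
  have "card (- (i ` S)) = card (- (i' ` S))"
    using bij_betw_same_card[OF 1] by (simp add: Compl_eq_Diff_UNIV card_Diff_subset)
  then obtain h where h: "bij_betw h (- (i ` S)) (- (i' ` S))"
    using finite_same_card_bij[of "- (i ` S)" "- (i' ` S)"] by auto
  define \<tau> where "\<tau> x = (if x \<in> i ` S then (i' \<circ> the_inv_into S i) x else h x)" for x
  have "bij_betw \<tau> (i ` S \<union> - (i ` S)) (i' ` S \<union> - (i' ` S))"
  proof (rule bij_betw_combine)
    show "bij_betw \<tau> (i ` S) (i' ` S)"
      using 1 by (subst bij_betw_cong[of _ _ "i' \<circ> the_inv_into S i"]) (auto simp: \<tau>_def)
    show "bij_betw \<tau> (- (i ` S)) (- (i' ` S))"
      using h by (subst bij_betw_cong[of _ _ h]) (auto simp: \<tau>_def)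
  qed auto
  then have "bij \<tau>" by simp
  moreover have "\<tau> (i a) = i' a" if "a \<in> S" for a
    using that assms(1) by (simp add: \<tau>_def the_inv_into_f_f)
  ultimately show ?thesis using that by blast
qed

lemma prod_if_one:
  "finite S \<Longrightarrow> (\<Prod>a\<in>S. if P a then z else 1) = (z :: 'a :: comm_monoid_mult) ^ card {a \<in> S. P a}"
  by (simp add: prod.inter_filter[symmetric])

lemma plane_rotation_sum:
  fixes f :: "'b :: finite \<Rightarrow> 'c :: real_algebra_1"
  assumes "q \<noteq> v"
  shows "(\<Sum>k\<in>UNIV. of_real (plane_rotation q v \<theta> x k) * f k) =
    (if x = q then of_real (cos \<theta>) * f q + of_real (sin \<theta>) * f v
     else if x = v then of_real (cos \<theta>) * f v - of_real (sin \<theta>) * f q else f x)"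
proof -
  have "of_real (plane_rotation q v \<theta> x k) * f k =
      (if k = q then if x = q then of_real (cos \<theta>) * f q else if x = v then - (of_real (sin \<theta>) * f q) else 0 else 0)
    + (if k = v then if x = q then of_real (sin \<theta>) * f v else if x = v then of_real (cos \<theta>) * f v else 0 else 0)
    + (if k = x then if x = q \<or> x = v then 0 else f x else 0)" for k
    using assms unfolding plane_rotation_def by auto
  then show ?thesis using assms by (simp add: sum.distrib)
qed

lemma unitary_plane_rotation:
  fixes q v :: "'n :: finite"
  assumes "q \<noteq> v"
  shows "unitary_mat (\<chi> x y. complex_of_real (plane_rotation q v \<theta> x y))" (is "unitary_mat ?U")
proof -
  have d: "dagger ?U $ x $ y = of_real (plane_rotation q v (- \<theta>) x y)" for x y
    using assms by (auto simp: dagger_def plane_rotation_def)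
  have c: "of_real (cos \<theta>) * of_real (cos \<theta>) + of_real (sin \<theta>) * of_real (sin \<theta>) = (1 :: complex)"
    unfolding of_real_mult[symmetric] of_real_add[symmetric]
    using sin_cos_squared_add3[of \<theta>] by simp
  have "?U ** dagger ?U = mat 1"
    using assms c
    unfolding vec_eq_iff matrix_matrix_mult_def vec_lambda_beta d plane_rotation_sum[OF assms]
    by (auto simp: plane_rotation_def mat_def algebra_simps)
  then show ?thesis unfolding unitary_mat_def using matrix_left_right_inverse by metis
qed

lemma prod_unitary_conjugation:
  fixes M U :: "complex^'n^'n"
  assumes "finite S"
  shows "(\<Prod>a\<in>S. (U ** M ** dagger U) $ i a $ j a)
    = (\<Sum>p\<in>PiE S (\<lambda>_. UNIV). \<Sum>r\<in>PiE S (\<lambda>_. UNIV).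
        (\<Prod>a\<in>S. U $ i a $ p a) * (\<Prod>a\<in>S. cnj (U $ j a $ r a)) * (\<Prod>a\<in>S. M $ p a $ r a))"
  unfolding unitary_conjugation_nth using assms
  by (simp add: prod_sum_PiE prod.distrib mult_ac)

lemma exp_bounded_norm: "exp_bounded (\<lambda>M :: complex^'n^'n. of_real (norm M))"
proof -
  have "norm (complex_of_real (norm M)) \<le> 1 * exp (1 * norm M)" for M :: "complex^'n^'n"
    using exp_ge_add_one_self[of "norm M"] by (simp del: exp_ge_add_one_self)
  then show ?thesis unfolding exp_bounded_def by (intro conjI continuous_intros) blast
qed

lemma exp_bounded_exp_norm: "exp_bounded (\<lambda>M :: complex^'n^'n. of_real (exp (c * norm M)))"
proof -
  have "norm (complex_of_real (exp (c * norm M))) \<le> 1 * exp (c * norm M)" for M :: "complex^'n^'n"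
    by simp
  then show ?thesis unfolding exp_bounded_def by (intro conjI continuous_intros) blast
qed

section \<open>From sums over partitions to sums over permutations\<close>

lemma partitions_of_eq_cycle_types:
  assumes "\<forall>p\<in>partitions. \<gamma> p \<in> conj_class p"
  shows "{p \<in> partitions. sum_mset p = k} = cycle_type k ` {g. g permutes {1..k}}"
proof
  \<comment> \<open>The representative \<open>\<gamma> p\<close> shows that every partition of
    \<open>k\<close> is a cycle type.\<close>
  show "{p \<in> partitions. sum_mset p = k} \<subseteq> cycle_type k ` {g. g permutes {1..k}}"
    using assms by (force simp: conj_class_def image_iff)
qed (use cycle_type_partition in auto)

text \<open>The permutations are grouped by cycle type, and the group belonging to \<open>p\<close>
  is \<open>conj_class p\<close>.\<close>

lemma sum_partitions_eq_sum_permutations: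
  fixes f :: "nat multiset \<Rightarrow> complex"
  assumes "\<forall>p\<in>partitions. \<gamma> p \<in> conj_class p"
  shows "(\<Sum>p | p \<in> partitions \<and> sum_mset p = k. of_nat (card (conj_class p)) * f p)
    = (\<Sum>g | g permutes {1..k}. f (cycle_type k g))"
proof -
  let ?S = "{g. g permutes {1..k}}" and ?T = "{p. p \<in> partitions \<and> sum_mset p = k}"
  have T: "?T = cycle_type k ` ?S" using partitions_of_eq_cycle_types[OF assms] .
  have fin: "finite ?S" by (simp add: finite_permutations)
  have "of_nat (card (conj_class p)) * f p
      = (\<Sum>g | g \<in> ?S \<and> cycle_type k g = p. f (cycle_type k g))" if "p \<in> ?T" for p
  proof -
    have "conj_class p = {g. g \<in> ?S \<and> cycle_type k g = p}"
      using that by (auto simp: conj_class_def)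
    then show ?thesis by simp
  qed
  then have "(\<Sum>p\<in>?T. of_nat (card (conj_class p)) * f p)
      = (\<Sum>p\<in>?T. \<Sum>g | g \<in> ?S \<and> cycle_type k g = p. f (cycle_type k g))"
    by (intro sum.cong) auto
  also have "\<dots> = (\<Sum>g\<in>?S. f (cycle_type k g))"
    using fin by (intro sum.group) (auto simp: T)
  finally show ?thesis .
qed

text \<open>The convention removes all partitions of size above \<open>CARD('n)\<close>, so the
  infinite sum is a finite one, sorted here by size.\<close>

lemma power_sum_expansion_eq:
  fixes A :: "complex^'n^'n"
  assumes "\<forall>p\<in>partitions. \<gamma> p \<in> conj_class p"
  shows "power_sum_expansion e A = (\<Sum>k\<le>CARD('n). of_nat CARD('n) ^ k / fact k
    * (\<Sum>g | g permutes {1..k}. e (cycle_type k g) * (\<Prod>d\<in>#cycle_type k g. trace (mat_pow A d))))"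
proof -
  let ?N = "CARD('n)"
  let ?t = "\<lambda>p. of_nat (card (conj_class p)) / fact (sum_mset p) * of_nat ?N ^ sum_mset p
        * (if sum_mset p > ?N then 0 else e p) * (\<Prod>d\<in>#p. trace (mat_pow A d))"
  let ?T = "\<lambda>k. {p. p \<in> partitions \<and> sum_mset p = k}"
  have fin: "finite (?T k)" for k
    unfolding partitions_of_eq_cycle_types[OF assms] by (simp add: finite_permutations)
  have U: "(\<Union>k\<le>?N. ?T k) = {p \<in> partitions. sum_mset p \<le> ?N}" by auto
  have "power_sum_expansion e A = infsum ?t (\<Union>k\<le>?N. ?T k)"
    unfolding power_sum_expansion_def U by (rule infsum_cong_neutral) auto
  also have "\<dots> = sum ?t (\<Union>k\<le>?N. ?T k)"
    using fin by (intro infsum_finite) auto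
  also have "\<dots> = (\<Sum>k\<le>?N. sum ?t (?T k))"
    using fin by (intro sum.UNION_disjoint) auto
  also have "\<dots> = (\<Sum>k\<le>?N. of_nat ?N ^ k / fact k * (\<Sum>p\<in>?T k.
      of_nat (card (conj_class p)) * (e p * (\<Prod>d\<in>#p. trace (mat_pow A d)))))"
    unfolding sum_distrib_left by (intro sum.cong refl) (auto simp: field_simps)
  finally show ?thesis unfolding sum_partitions_eq_sum_permutations[OF assms] .
qed

text \<open>A common setting for both claims: a genuine measure with a constant normalising weight,
  and the Gaussian measure with a weight polynomial in traces of powers. The weight may be complex,
  so no positivity is assumed.\<close>

locale invariant_weight =
  fixes \<nu> :: "(complex^'n::finite^'n) measure" and w :: "complex^'n^'n \<Rightarrow> complex"
  assumes invariant_\<nu>: "unitarily_invariant_measure \<nu>"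
    and invariant_w: "\<And>U M. unitary_mat U \<Longrightarrow> M \<in> hermitian_mats \<Longrightarrow> w (U ** M ** dagger U) = w M"
    and integrable_ext_weight: "\<And>A. A \<in> hermitian_mats \<Longrightarrow> integrable \<nu> (\<lambda>M. w M * ext_weight A M)"
begin

lemma sets_\<nu>: "sets \<nu> = sets (restrict_space borel hermitian_mats)"
  using invariant_\<nu> by (simp add: unitarily_invariant_measure_def)

lemma space_\<nu>: "space \<nu> = hermitian_mats"
  using sets_eq_imp_space_eq[OF sets_\<nu>] by (simp add: space_restrict_space)

lemma measurable_continuous:
  assumes "continuous_on UNIV f"
  shows "f \<in> borel_measurable \<nu>"
  unfolding measurable_cong_sets[OF sets_\<nu> refl]
  by (intro measurable_restrict_space1 borel_measurable_continuous_onI assms)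

lemma w_measurable: "w \<in> borel_measurable \<nu>"
proof -
  have "(0 :: complex^'n^'n) \<in> hermitian_mats"
    by (simp add: hermitian_mats_def dagger_def vec_eq_iff)
  from borel_measurable_integrable[OF integrable_ext_weight[OF this]]
  show ?thesis by (simp add: ext_weight_def trace_def)
qed

text \<open>For \<open>M\<close> and \<open>A\<close> Hermitian, \<open>Tr (M A)\<close> is the real inner product of \<open>M\<close> and \<open>A\<close>, so
  \<open>exp (c \<parallel>M\<parallel>)\<close> is dominated by a finite sum of exponentials \<open>exp (N Tr (M A))\<close>.\<close>
lemma integrable_exp_bounded:
  assumes f: "exp_bounded f"
  shows "integrable \<nu> (\<lambda>M. w M * f M)"
proof -
  obtain C c where C: "0 \<le> C" and c: "0 \<le> c" and le: "\<And>M. norm (f M) \<le> C * exp (c * norm M)"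
    using exp_boundedE[OF f] by metis
  let ?N = "real CARD('n)" and ?D = "real DIM(complex^'n^'n)"
  \<comment> \<open>Basis matrices of the ambient space need not be Hermitian; their Hermitian parts
    have the same inner products with Hermitian \<open>M\<close>.\<close>
  define H where "H b = (1 / 2) *\<^sub>R (b + dagger b)" for b :: "complex^'n^'n"
  \<comment> \<open>The scaling cancels the factor \<open>CARD('n)\<close> in
    \<open>ext_weight\<close> and yields the exponents of
    \<open>exp_norm_le_sum_exp\<close>.\<close>
  define B where "B b = (c * ?D / ?N) *\<^sub>R H b" for b
  have H: "M \<bullet> H b = M \<bullet> b" if "M \<in> hermitian_mats" for M b
    using that inner_dagger[of M b] by (simp add: H_def inner_add_right hermitian_mats_def)
  have Hh: "r *\<^sub>R H b \<in> hermitian_mats" for r b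
    by (simp add: H_def hermitian_mats_def linear_scale[OF linear_dagger] linear_add[OF linear_dagger] add.commute)
  have ew: "ext_weight (r *\<^sub>R H b) M = of_real (exp (?N * r * (M \<bullet> b)))" if "M \<in> hermitian_mats" for M b r
    using trace_mult_hermitian[OF that Hh[of r b]] H[OF that, of b]
    by (simp add: ext_weight_def exp_of_real[symmetric] mult.assoc)
  let ?g = "\<lambda>M. C * (\<Sum>b\<in>Basis. norm (w M * ext_weight (B b) M) + norm (w M * ext_weight (- B b) M))"
  have Bh: "B b \<in> hermitian_mats" "- B b \<in> hermitian_mats" for b
    using Hh[of "c * ?D / ?N" b] Hh[of "- (c * ?D / ?N)" b] by (simp_all add: B_def)
  show ?thesis
  proof (rule Bochner_Integration.integrable_bound)
    show "integrable \<nu> ?g"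
      using integrable_ext_weight Bh
      by (intro integrable_mult_right Bochner_Integration.integrable_sum
          Bochner_Integration.integrable_add integrable_norm) auto
    show "(\<lambda>M. w M * f M) \<in> borel_measurable \<nu>"
      using f by (intro borel_measurable_times w_measurable measurable_continuous)
        (simp add: exp_bounded_def)
    show "AE M in \<nu>. norm (w M * f M) \<le> norm (?g M)"
    proof (rule AE_I2)
      fix M assume "M \<in> space \<nu>"
      then have M: "M \<in> hermitian_mats" by (simp add: space_\<nu>)
      have e1: "norm (w M * ext_weight (B b) M) = norm (w M) * exp (c * ?D * (M \<bullet> b))" for b
        using ew[OF M, of "c * ?D / ?N" b] by (simp add: B_def norm_mult)
      have e2: "norm (w M * ext_weight (- B b) M) = norm (w M) * exp (- (c * ?D * (M \<bullet> b)))" for b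
        using ew[OF M, of "- (c * ?D / ?N)" b] by (simp add: B_def norm_mult)
      have "norm (w M * f M) \<le> norm (w M) * (C * exp (c * norm M))"
        unfolding norm_mult by (intro mult_left_mono le) simp
      also have "\<dots> \<le> norm (w M) * (C * (\<Sum>b\<in>Basis. exp (c * ?D * (M \<bullet> b)) + exp (- (c * ?D * (M \<bullet> b)))))"
        by (intro mult_left_mono exp_norm_le_sum_exp c C) simp
      also have "\<dots> = ?g M"
        unfolding e1 e2 by (simp add: sum_distrib_left sum_distrib_right algebra_simps)
      finally show "norm (w M * f M) \<le> norm (?g M)" by simp
    qed
  qed
qed

lemma integral_unitary_conjugation:
  assumes f: "exp_bounded f" and U: "unitary_mat U"
  shows "(LINT M|\<nu>. w M * f (U ** M ** dagger U)) = (LINT M|\<nu>. w M * f M)"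
proof -
  let ?\<Phi> = "\<lambda>M. U ** M ** dagger U"
  have "?\<Phi> \<in> borel_measurable borel"
    by (intro borel_measurable_continuous_onI linear_continuous_on)
      (simp add: linear_conv_bounded_linear[symmetric] linear_unitary_conjugation)
  then have \<Phi>: "?\<Phi> \<in> measurable \<nu> \<nu>"
    unfolding measurable_cong_sets[OF sets_\<nu> sets_\<nu>]
    by (intro measurable_restrict_space2 measurable_restrict_space1)
      (auto simp: space_restrict_space intro: hermitian_unitary_conjugation)
  have "(LINT M|\<nu>. w M * f M) = (LINT M|distr \<nu> \<nu> ?\<Phi>. w M * f M)"
    using invariant_\<nu> U by (simp add: unitarily_invariant_measure_def)
  also have "\<dots> = (LINT M|\<nu>. w (?\<Phi> M) * f (?\<Phi> M))"
    using f by (intro integral_distr \<Phi> borel_measurable_times w_measurable measurable_continuous)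
      (simp add: exp_bounded_def)
  also have "\<dots> = (LINT M|\<nu>. w M * f (?\<Phi> M))"
    by (intro Bochner_Integration.integral_cong refl) (simp add: invariant_w[OF U] space_\<nu>)
  finally show ?thesis ..
qed

section \<open>Moments of the matrix entries\<close>

definition moment :: "nat set \<Rightarrow> (nat \<Rightarrow> 'n) \<Rightarrow> (nat \<Rightarrow> 'n) \<Rightarrow> complex" where
  "moment S i j = (LINT M|\<nu>. w M * (\<Prod>a\<in>S. M $ i a $ j a))"

lemma moment_cong:
  "(\<And>a. a \<in> S \<Longrightarrow> i a = i' a) \<Longrightarrow> (\<And>a. a \<in> S \<Longrightarrow> j a = j' a) \<Longrightarrow> moment S i j = moment S i' j'"
  unfolding moment_def by (simp cong: prod.cong)

lemma exp_bounded_prod_nth [intro]: "exp_bounded (\<lambda>M. \<Prod>a\<in>S. M $ i a $ j a)"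
  by (intro exp_bounded_prod) simp

text \<open>Conjugation by the phase \<open>cis \<theta>\<close> at \<open>v\<close> multiplies the
  moment by \<open>cis ((?m - ?n) * \<theta>)\<close>. The angle is chosen to make this factor -1,
  so the moment equals its negative.\<close>

lemma moment_unbalanced:
  assumes S: "finite S" and ne: "card {a \<in> S. i a = v} \<noteq> card {a \<in> S. j a = v}"
  shows "moment S i j = 0"
proof -
  let ?m = "card {a \<in> S. i a = v}" and ?n = "card {a \<in> S. j a = v}"
  define \<theta> where "\<theta> = pi / (real ?m - real ?n)"
  have "cis \<theta> ^ ?m * cnj (cis \<theta>) ^ ?n = cis (real ?m * \<theta> - real ?n * \<theta>)"
    by (simp add: Complex.DeMoivre cis_cnj cis_mult)
  also have "real ?m * \<theta> - real ?n * \<theta> = pi"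
    unfolding left_diff_distrib[symmetric] using ne by (simp add: \<theta>_def)
  finally have z: "cis \<theta> ^ ?m * cnj (cis \<theta>) ^ ?n = - 1" by simp
  have "cis \<theta> * cnj (cis \<theta>) = 1" by (simp add: cis_cnj cis_mult)
  from integral_unitary_conjugation[OF exp_bounded_prod_nth unitary_diagonal_phase[OF this]]
  have "moment S i j = (LINT M|\<nu>. w M * (\<Prod>a\<in>S. (if i a = v then cis \<theta> else 1) * M $ i a $ j a
      * cnj (if j a = v then cis \<theta> else 1)))"
    unfolding moment_def diagonal_phase_conjugation by metis
  also have "\<dots> = (LINT M|\<nu>. (cis \<theta> ^ ?m * cnj (cis \<theta>) ^ ?n) * (w M * (\<Prod>a\<in>S. M $ i a $ j a)))"
    using S by (simp add: prod.distrib prod_if_one if_distrib[of cnj] mult_ac cong: if_cong)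
  also have "\<dots> = - moment S i j" unfolding z by (simp add: moment_def)
  finally show ?thesis by simp
qed

lemma moment_permute:
  assumes "bij \<tau>"
  shows "moment S (\<tau> \<circ> i) (\<tau> \<circ> j) = moment S i j"
  using integral_unitary_conjugation[OF exp_bounded_prod_nth[where S = S and i = i and j = j] unitary_permutation_matrix[OF assms]]
  unfolding moment_def permutation_matrix_conjugation by simp

lemma moment_rotation:
  assumes S: "finite S" and qv: "q \<noteq> v"
  shows "moment S i j = (\<Sum>p\<in>PiE S (\<lambda>_. UNIV). \<Sum>r\<in>PiE S (\<lambda>_. UNIV).
      of_real ((\<Prod>a\<in>S. plane_rotation q v \<theta> (i a) (p a))
        * (\<Prod>a\<in>S. plane_rotation q v \<theta> (j a) (r a))) * moment S p r)"
proof -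
  let ?R = "plane_rotation q v \<theta>"
  have "moment S i j = (LINT M|\<nu>. w M * (\<Sum>p\<in>PiE S (\<lambda>_. UNIV). \<Sum>r\<in>PiE S (\<lambda>_. UNIV).
      of_real ((\<Prod>a\<in>S. ?R (i a) (p a)) * (\<Prod>a\<in>S. ?R (j a) (r a))) * (\<Prod>a\<in>S. M $ p a $ r a)))"
    using integral_unitary_conjugation[OF exp_bounded_prod_nth[where S = S and i = i and j = j] unitary_plane_rotation[OF qv]]
    unfolding moment_def prod_unitary_conjugation[OF S] by simp
  also have "\<dots> = (LINT M|\<nu>. (\<Sum>p\<in>PiE S (\<lambda>_. UNIV). \<Sum>r\<in>PiE S (\<lambda>_. UNIV).
      of_real ((\<Prod>a\<in>S. ?R (i a) (p a)) * (\<Prod>a\<in>S. ?R (j a) (r a))) * (w M * (\<Prod>a\<in>S. M $ p a $ r a))))"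
    by (simp add: sum_distrib_left mult_ac)
  also have "\<dots> = (\<Sum>p\<in>PiE S (\<lambda>_. UNIV). \<Sum>r\<in>PiE S (\<lambda>_. UNIV).
      of_real ((\<Prod>a\<in>S. ?R (i a) (p a)) * (\<Prod>a\<in>S. ?R (j a) (r a))) * moment S p r)"
    unfolding moment_def
    by (subst Bochner_Integration.integral_sum, (intro Bochner_Integration.integrable_sum
          integrable_mult_right integrable_exp_bounded exp_bounded_prod_nth)[1],
        subst Bochner_Integration.integral_sum, (intro
          integrable_mult_right integrable_exp_bounded exp_bounded_prod_nth)[1], simp)
  finally show ?thesis .
qed

text \<open>The assumptions of \<open>eq_permutation_sum\<close> come from phases, rotations and
  permutation matrices; the last carry any injective tuple to \<open>idx\<close>, which identifies
  its moment with that of \<open>perm_obs\<close>.\<close>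

lemma moment_eq_permutation_sum:
  assumes idx: "bij_betw idx {1..CARD('n)} UNIV" and k: "k \<le> CARD('n)"
  shows "moment {1..k} i j = permutation_sum {1..k} (\<lambda>g. LINT M|\<nu>. w M * perm_obs idx k g M) i j"
proof (rule eq_permutation_sum)
  show "card {1..k} \<le> CARD('n)" using k by simp
  show "moment {1..k} i j = (\<Sum>b | b \<in> {1..k} \<and> j b = i a. moment {1..k} (i(a := q)) (j(b := q)))"
    if "a \<in> {1..k}" "q \<notin> i ` {1..k}" "q \<notin> j ` {1..k}" for i j a q
    by (rule rotation_invariant_rec[OF finite_atLeastAtMost moment_unbalanced moment_rotation _ that])
      (auto intro: moment_cong)
  show "moment {1..k} i (i \<circ> g) = (LINT M|\<nu>. w M * perm_obs idx k g M)"
    if i: "inj_on i {1..k}" and g: "g permutes {1..k}" for i g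
  proof -
    have "inj_on idx {1..k}"
      using bij_betw_imp_inj_on[OF idx] by (rule inj_on_subset) (use k in auto)
    from bij_extending_injections[OF i this] obtain \<tau> where
      \<tau>: "bij \<tau>" "\<And>a. a \<in> {1..k} \<Longrightarrow> \<tau> (i a) = idx a" by blast
    have "moment {1..k} i (i \<circ> g) = moment {1..k} (\<tau> \<circ> i) (\<tau> \<circ> (i \<circ> g))"
      using moment_permute[OF \<tau>(1)] by simp
    also have "\<dots> = moment {1..k} idx (idx \<circ> g)"
      by (rule moment_cong) (use \<tau>(2) permutes_in_image[OF g] in auto)
    finally show ?thesis by (simp add: moment_def perm_obs_def)
  qed
qed (auto intro: moment_unbalanced moment_cong)

text \<open>Permutations of equal cycle type are conjugate by some \<open>\<tau>\<close>, and the
  relabelling \<open>\<tau>\<close> of the positions extends along \<open>idx\<close> to a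
  permutation matrix, which preserves moments.\<close>

lemma integral_perm_obs_cong:
  assumes idx: "bij_betw idx {1..CARD('n)} UNIV" and k: "k \<le> CARD('n)"
    and g: "g permutes {1..k}" and g': "g' permutes {1..k}" and ct: "cycle_type k g = cycle_type k g'"
  shows "(LINT M|\<nu>. w M * perm_obs idx k g M) = (LINT M|\<nu>. w M * perm_obs idx k g' M)"
proof -
  obtain \<tau> where \<tau>: "bij_betw \<tau> {1..k} {1..k}" "\<And>a. a \<in> {1..k} \<Longrightarrow> \<tau> (g a) = g' (\<tau> a)"
    using conjugate_of_cycle_type_eq[OF g g' ct] by blast
  have S: "a \<in> {1..k} \<Longrightarrow> a \<in> {1..CARD('n)}" for a using k by simp
  have \<tau>S: "\<tau> a \<in> {1..k}" if "a \<in> {1..k}" for a using bij_betwE[OF \<tau>(1)] that by blast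
  have inj: "inj_on idx {1..k}"
    using bij_betw_imp_inj_on[OF idx] by (rule inj_on_subset) (use k in auto)
  then have "inj_on idx (\<tau> ` {1..k})" using bij_betw_imp_surj_on[OF \<tau>(1)] by simp
  then have "inj_on (idx \<circ> \<tau>) {1..k}"
    using bij_betw_imp_inj_on[OF \<tau>(1)] by (intro comp_inj_on)
  from bij_extending_injections[OF inj this] obtain \<rho> where
    \<rho>: "bij \<rho>" "\<And>a. a \<in> {1..k} \<Longrightarrow> \<rho> (idx a) = idx (\<tau> a)" by auto
  have "perm_obs idx k g' M = (\<Prod>a\<in>{1..k}. M $ idx (\<tau> a) $ idx (g' (\<tau> a)))" for M
    unfolding perm_obs_def by (rule prod.reindex_bij_betw[OF \<tau>(1), symmetric])
  also have "\<dots> M = (\<Prod>a\<in>{1..k}. M $ \<rho> (idx a) $ \<rho> (idx (g a)))" for M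
    by (intro prod.cong refl) (simp only: \<tau>(2)[symmetric] \<rho>(2) permutes_in_image[OF g])
  finally have "(LINT M|\<nu>. w M * perm_obs idx k g' M) = moment {1..k} (\<rho> \<circ> idx) (\<rho> \<circ> (idx \<circ> g))"
    by (simp add: moment_def)
  also have "\<dots> = (LINT M|\<nu>. w M * perm_obs idx k g M)"
    unfolding moment_permute[OF \<rho>(1)] by (simp add: moment_def perm_obs_def)
  finally show ?thesis ..
qed

text \<open>The power is expanded over row tuples \<open>i\<close> and column tuples
  \<open>j\<close>. The moment is a sum over the permutations with \<open>j = i \<circ> g\<close>,
  which collapses the sum over \<open>j\<close>; the remaining sum over \<open>i\<close> is a
  product of traces over the cycles of \<open>g\<close>.\<close>

lemma integral_trace_power:
  assumes idx: "bij_betw idx {1..CARD('n)} UNIV" and k: "k \<le> CARD('n)"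
  shows "(LINT M|\<nu>. w M * trace (M ** A) ^ k)
    = (\<Sum>g | g permutes {1..k}. (LINT M|\<nu>. w M * perm_obs idx k g M)
        * (\<Prod>d\<in>#cycle_type k g. trace (mat_pow A d)))"
proof -
  let ?S = "{1..k}"
  let ?E = "PiE ?S (\<lambda>_. UNIV :: 'n set)"
  let ?c = "\<lambda>g. LINT M|\<nu>. w M * perm_obs idx k g M"
  have e: "(\<forall>a\<in>?S. (i \<circ> g) a = j a) \<longleftrightarrow> (\<forall>a\<in>?S. j a = i (g a))" for i j :: "nat \<Rightarrow> 'n" and g
    by auto
  have "trace (M ** A) ^ k = (\<Prod>a\<in>?S. \<Sum>x\<in>UNIV. \<Sum>y\<in>UNIV. M $ x $ y * A $ y $ x)" for M
    unfolding trace_mult_sum by simp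
  also have "\<dots> M = (\<Sum>i\<in>?E. \<Sum>j\<in>?E. (\<Prod>a\<in>?S. M $ i a $ j a) * (\<Prod>a\<in>?S. A $ j a $ i a))" for M
    by (simp only: prod_sum_PiE finite_atLeastAtMost finite prod.distrib)
  finally have "(LINT M|\<nu>. w M * trace (M ** A) ^ k)
      = (LINT M|\<nu>. (\<Sum>i\<in>?E. \<Sum>j\<in>?E. (w M * (\<Prod>a\<in>?S. M $ i a $ j a)) * (\<Prod>a\<in>?S. A $ j a $ i a)))"
    by (simp add: sum_distrib_left mult.assoc)
  also have "\<dots> = (\<Sum>i\<in>?E. \<Sum>j\<in>?E. moment ?S i j * (\<Prod>a\<in>?S. A $ j a $ i a))"
    unfolding moment_def
    by (subst Bochner_Integration.integral_sum, (intro Bochner_Integration.integrable_sum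
          integrable_mult_left integrable_exp_bounded exp_bounded_prod_nth)[1],
        subst Bochner_Integration.integral_sum, (intro
          integrable_mult_left integrable_exp_bounded exp_bounded_prod_nth)[1], simp)
  also have "\<dots> = (\<Sum>i\<in>?E. \<Sum>j\<in>?E. \<Sum>g | g permutes ?S.
      ?c g * (of_bool (\<forall>a\<in>?S. (i \<circ> g) a = j a) * (\<Prod>a\<in>?S. A $ j a $ i a)))"
    unfolding moment_eq_permutation_sum[OF idx k] permutation_sum_def sum_distrib_right e
    by (intro sum.cong refl) simp
  also have "\<dots> = (\<Sum>i\<in>?E. \<Sum>g | g permutes ?S. ?c g *
      (\<Sum>j\<in>?E. of_bool (\<forall>a\<in>?S. (i \<circ> g) a = j a) * (\<Prod>a\<in>?S. A $ j a $ i a)))"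
    unfolding sum_distrib_left by (intro sum.cong refl sum.swap)
  also have "\<dots> = (\<Sum>i\<in>?E. \<Sum>g | g permutes ?S. ?c g * (\<Prod>a\<in>?S. A $ i (g a) $ i a))"
    by (subst sum_PiE_delta) simp_all
  also have "\<dots> = (\<Sum>g | g permutes ?S. ?c g * (\<Sum>i\<in>?E. \<Prod>a\<in>?S. A $ i (g a) $ i a))"
    unfolding sum_distrib_left by (rule sum.swap)
  also have "\<dots> = (\<Sum>g | g permutes ?S. ?c g * (\<Prod>d\<in>#cycle_type k g. trace (mat_pow A d)))"
    by (intro sum.cong refl) (simp only: mem_Collect_eq perm_sum_eq_prod_trace)
  finally show ?thesis .
qed

text \<open>No error term occurs here: cutting the exponential series after order
  \<open>CARD('n)\<close> matches the cutoff in the expansion.\<close>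

lemma integral_exp_partial_sum:
  assumes idx: "bij_betw idx {1..CARD('n)} UNIV"
    and \<gamma>: "\<forall>p\<in>partitions. \<gamma> p \<in> conj_class p"
  shows "(LINT M|\<nu>. w M * (\<Sum>k\<le>CARD('n). (of_nat CARD('n) * trace (M ** A)) ^ k / fact k))
    = power_sum_expansion (\<lambda>p. LINT M|\<nu>. w M * perm_obs idx (sum_mset p) (\<gamma> p) M) A"
proof -
  let ?N = "CARD('n)"
  have "(LINT M|\<nu>. w M * (\<Sum>k\<le>?N. (of_nat ?N * trace (M ** A)) ^ k / fact k))
      = (LINT M|\<nu>. (\<Sum>k\<le>?N. (of_nat ?N ^ k / fact k) * (w M * trace (M ** A) ^ k)))"
    by (simp add: sum_distrib_left power_mult_distrib mult_ac)
  also have "\<dots> = (\<Sum>k\<le>?N. of_nat ?N ^ k / fact k * (LINT M|\<nu>. w M * trace (M ** A) ^ k))"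
    by (subst Bochner_Integration.integral_sum, (intro integrable_mult_right integrable_exp_bounded
          exp_bounded_power exp_bounded_trace_mult)[1], simp only: integral_mult_right_zero)
  also have "\<dots> = (\<Sum>k\<le>?N. of_nat ?N ^ k / fact k * (\<Sum>g | g permutes {1..k}.
      (LINT M|\<nu>. w M * perm_obs idx (sum_mset (cycle_type k g)) (\<gamma> (cycle_type k g)) M)
      * (\<Prod>d\<in>#cycle_type k g. trace (mat_pow A d))))"
  proof (intro sum.cong refl arg_cong2[where f = "(*)"])
    fix k assume "k \<in> {..?N}"
    then have k: "k \<le> ?N" by simp
    \<comment> \<open>Each permutation is replaced by the chosen representative of its
      class.\<close>
    have "(LINT M|\<nu>. w M * perm_obs idx k g M)
        = (LINT M|\<nu>. w M * perm_obs idx (sum_mset (cycle_type k g)) (\<gamma> (cycle_type k g)) M)"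
      if g: "g permutes {1..k}" for g
    proof -
      have "\<gamma> (cycle_type k g) \<in> conj_class (cycle_type k g)"
        using \<gamma> cycle_type_partition(1)[OF g] by blast
      then have "\<gamma> (cycle_type k g) permutes {1..k}"
        "cycle_type k (\<gamma> (cycle_type k g)) = cycle_type k g"
        unfolding conj_class_def cycle_type_partition(2)[OF g] by auto
      then show ?thesis
        unfolding cycle_type_partition(2)[OF g]
        by (intro integral_perm_obs_cong[OF idx k g]) auto
    qed
    then show "(LINT M|\<nu>. w M * trace (M ** A) ^ k) = (\<Sum>g | g permutes {1..k}.
      (LINT M|\<nu>. w M * perm_obs idx (sum_mset (cycle_type k g)) (\<gamma> (cycle_type k g)) M)
      * (\<Prod>d\<in>#cycle_type k g. trace (mat_pow A d)))"
      unfolding integral_trace_power[OF idx k] by (intro sum.cong) auto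
  qed
  also have "\<dots> = power_sum_expansion (\<lambda>p. LINT M|\<nu>. w M * perm_obs idx (sum_mset p) (\<gamma> p) M) A"
    unfolding power_sum_expansion_eq[OF \<gamma>] ..
  finally show ?thesis .
qed

text \<open>The difference is the integral of the Taylor remainder of the exponential, which is
  bounded by \<open>norm A ^ (CARD('n) + 1)\<close> times an integrable function of
  \<open>M\<close>.\<close>

lemma expansion_bigo:
  assumes idx: "bij_betw idx {1..CARD('n)} UNIV"
    and \<gamma>: "\<forall>p\<in>partitions. \<gamma> p \<in> conj_class p"
  shows "(\<lambda>A. (LINT M|\<nu>. w M * ext_weight A M)
      - power_sum_expansion (\<lambda>p. LINT M|\<nu>. w M * perm_obs idx (sum_mset p) (\<gamma> p) M) A)
    \<in> O[at 0 within hermitian_mats](\<lambda>A. of_real (norm A ^ (CARD('n) + 1)))"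
proof -
  let ?N = "CARD('n)"
  \<comment> \<open>The dominating function must not depend on \<open>A\<close>; it is
    complex-valued so that \<open>integrable_exp_bounded\<close> applies.\<close>
  define h where "h M = complex_of_real (exp (real ?N * norm M)) * (of_nat ?N * of_real (norm M)) ^ (?N + 1)"
    for M :: "complex^'n^'n"
  have h: "exp_bounded h"
    unfolding h_def by (intro exp_bounded_mult exp_bounded_exp_norm exp_bounded_power exp_bounded_norm) simp
  have norm_h: "norm (h M) = exp (real ?N * norm M) * (real ?N * norm M) ^ (?N + 1)" for M
    by (simp add: h_def norm_mult norm_power)
  have bound: "norm ((LINT M|\<nu>. w M * ext_weight A M)
      - power_sum_expansion (\<lambda>p. LINT M|\<nu>. w M * perm_obs idx (sum_mset p) (\<gamma> p) M) A)
      \<le> (LINT M|\<nu>. norm (w M * h M)) * norm (complex_of_real (norm A ^ (?N + 1)))"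
    if A: "A \<in> hermitian_mats" "norm A \<le> 1" for A :: "complex^'n^'n"
  proof -
    let ?z = "\<lambda>M. of_nat ?N * trace (M ** A)"
    let ?p = "\<lambda>M. \<Sum>k\<le>?N. ?z M ^ k / fact k"
    have p: "exp_bounded ?p"
      unfolding divide_inverse by (intro exp_bounded_sum exp_bounded_mult exp_bounded_power) auto
    have i1: "integrable \<nu> (\<lambda>M. w M * ext_weight A M)" using A by (intro integrable_ext_weight)
    have i2: "integrable \<nu> (\<lambda>M. w M * ?p M)" by (rule integrable_exp_bounded[OF p])
    have i3: "integrable \<nu> (\<lambda>M. norm (w M * h M) * norm A ^ (?N + 1))"
      by (intro integrable_mult_left integrable_norm integrable_exp_bounded h)
    have "(LINT M|\<nu>. w M * ext_weight A M)
        - power_sum_expansion (\<lambda>p. LINT M|\<nu>. w M * perm_obs idx (sum_mset p) (\<gamma> p) M) A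
        = (LINT M|\<nu>. w M * ext_weight A M - w M * ?p M)"
      unfolding integral_exp_partial_sum[OF idx \<gamma>, symmetric]
      by (rule Bochner_Integration.integral_diff[OF i1 i2, symmetric])
    also have "norm \<dots> \<le> (LINT M|\<nu>. norm (w M * h M) * norm A ^ (?N + 1))"
    proof (rule Bochner_Integration.integral_norm_bound_integral[OF _ i3])
      show "integrable \<nu> (\<lambda>M. w M * ext_weight A M - w M * ?p M)"
        by (rule Bochner_Integration.integrable_diff[OF i1 i2])
      fix M assume "M \<in> space \<nu>"
      then have M: "M \<in> hermitian_mats" by (simp add: space_\<nu>)
      have "norm (trace (M ** A)) \<le> norm M * norm A"
        unfolding trace_mult_hermitian[OF M A(1)] using Cauchy_Schwarz_ineq2[of M A] by simp
      then have z: "norm (?z M) \<le> real ?N * norm M * norm A"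
        by (simp add: norm_mult mult.assoc mult_left_mono)
      \<comment> \<open>The restriction to \<open>norm A \<le> 1\<close> frees the exponential
        factor of the remainder from \<open>A\<close>; the sharper bound is kept for the
        power.\<close>
      also have "\<dots> \<le> real ?N * norm M" using A(2) by (simp add: mult_left_le)
      finally have z': "norm (?z M) \<le> real ?N * norm M" .
      have "norm (exp (?z M) - ?p M) \<le> exp (norm (?z M)) * norm (?z M) ^ Suc ?N / fact ?N"
        by (rule Taylor_exp_field)
      also have "\<dots> \<le> exp (norm (?z M)) * norm (?z M) ^ Suc ?N / 1"
        by (intro divide_left_mono) (auto simp: fact_ge_1)
      also have "\<dots> \<le> exp (real ?N * norm M) * (real ?N * norm M * norm A) ^ Suc ?N / 1"
        using z z' by (intro divide_right_mono mult_mono power_mono) auto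
      also have "\<dots> = norm (h M) * norm A ^ (?N + 1)"
        unfolding norm_h by (simp add: power_mult_distrib)
      finally have "norm (w M) * norm (exp (?z M) - ?p M) \<le> norm (w M) * (norm (h M) * norm A ^ (?N + 1))"
        by (rule mult_left_mono) simp
      then show "norm (w M * ext_weight A M - w M * ?p M) \<le> norm (w M * h M) * norm A ^ (?N + 1)"
        unfolding ext_weight_def right_diff_distrib[symmetric] norm_mult by (simp add: mult.assoc)
    qed
    also have "\<dots> = (LINT M|\<nu>. norm (w M * h M)) * norm (complex_of_real (norm A ^ (?N + 1)))"
      by (simp add: norm_power del: power_Suc)
    finally show ?thesis .
  qed
  show ?thesis
  proof (rule bigoI)
    show "\<forall>\<^sub>F A in at 0 within hermitian_mats. norm ((LINT M|\<nu>. w M * ext_weight A M)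
      - power_sum_expansion (\<lambda>p. LINT M|\<nu>. w M * perm_obs idx (sum_mset p) (\<gamma> p) M) A)
      \<le> (LINT M|\<nu>. norm (w M * h M)) * norm (complex_of_real (norm A ^ (?N + 1)))"
      unfolding eventually_at
    proof (intro exI[of _ 1] conjI ballI impI)
      fix A :: "complex^'n^'n"
      assume "A \<in> hermitian_mats" "A \<noteq> 0 \<and> dist A 0 < 1"
      then show "norm ((LINT M|\<nu>. w M * ext_weight A M)
        - power_sum_expansion (\<lambda>p. LINT M|\<nu>. w M * perm_obs idx (sum_mset p) (\<gamma> p) M) A)
        \<le> (LINT M|\<nu>. norm (w M * h M)) * norm (complex_of_real (norm A ^ (?N + 1)))"
        by (intro bound) auto
    qed simp
  qed
qed

end

section \<open>The Gaussian measure\<close>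

lemma nn_integral_lborel_translate:
  fixes f :: "'a :: euclidean_space \<Rightarrow> ennreal"
  assumes [measurable]: "f \<in> borel_measurable borel"
  shows "(\<integral>\<^sup>+x. f (c + x) \<partial>lborel) = (\<integral>\<^sup>+x. f x \<partial>lborel)"
  by (subst (2) lborel_distr_plus[of c, symmetric], subst nn_integral_distr) auto

lemma nn_integral_lborel_reflect:
  fixes f :: "'a :: euclidean_space \<Rightarrow> ennreal"
  assumes [measurable]: "f \<in> borel_measurable borel"
  shows "(\<integral>\<^sup>+x. f (c - x) \<partial>lborel) = (\<integral>\<^sup>+x. f x \<partial>lborel)"
proof -
  have "lborel = distr lborel borel (\<lambda>x. c - x)"
    using lborel_affine[of "-1" c] by (simp add: density_1)
  then have "(\<integral>\<^sup>+x. f x \<partial>lborel) = (\<integral>\<^sup>+x. f x \<partial>distr lborel borel (\<lambda>x. c - x))" by simp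
  also have "\<dots> = (\<integral>\<^sup>+x. f (c - x) \<partial>lborel)" by (subst nn_integral_distr) auto
  finally show ?thesis ..
qed

text \<open>The classical argument for the uniqueness of Haar measure: with \<open>\<nu>(A) = \<lambda>(T\<^sup>-\<^sup>1 A)\<close>,
  translation invariance and Fubini give \<open>\<nu>(A) \<lambda>(B) = \<nu>(B) \<lambda>(A)\<close>, and \<open>\<nu>\<close> and \<open>\<lambda>\<close> agree
  on the unit ball \<open>B\<close>.\<close>
lemma lborel_distr_linear_isometry:
  fixes T :: "'a :: euclidean_space \<Rightarrow> 'a"
  assumes T: "linear T" and iso: "\<And>x. norm (T x) = norm x"
  shows "distr lborel borel T = lborel"
proof -
  have [measurable]: "T \<in> borel_measurable borel"
    using T by (intro borel_measurable_continuous_onI linear_continuous_on)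
      (simp add: linear_conv_bounded_linear)
  have "inj T"
    unfolding linear_injective_0[OF T] using iso by (metis norm_eq_zero)
  then have surj: "surj T" by (rule linear_injective_imp_surjective[OF T]) (rule refl)
  have swap: "(\<integral>\<^sup>+x. indicator A (T x) \<partial>lborel) * emeasure lborel B
      = (\<integral>\<^sup>+x. indicator B (T x) \<partial>lborel) * emeasure lborel A"
    if [measurable]: "A \<in> sets borel" "B \<in> sets borel" for A B :: "'a set"
  proof -
    have "(\<integral>\<^sup>+x. indicator A (T x) \<partial>lborel) * emeasure lborel B
        = (\<integral>\<^sup>+x. \<integral>\<^sup>+y. indicator A (T x) * indicator B y \<partial>lborel \<partial>lborel)"
      by (simp add: nn_integral_cmult nn_integral_multc)
    also have "\<dots> = (\<integral>\<^sup>+x. \<integral>\<^sup>+y. indicator A (T x) * indicator B (T x + y) \<partial>lborel \<partial>lborel)"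
    proof (rule nn_integral_cong)
      fix x
      show "(\<integral>\<^sup>+y. indicator A (T x) * indicator B y \<partial>lborel :: ennreal)
          = (\<integral>\<^sup>+y. indicator A (T x) * indicator B (T x + y) \<partial>lborel)"
        by (rule nn_integral_lborel_translate[where c = "T x"
              and f = "\<lambda>y. indicator A (T x) * indicator B y", symmetric]) simp
    qed
    also have "\<dots> = (\<integral>\<^sup>+y. \<integral>\<^sup>+x. indicator A (T x) * indicator B (T x + y) \<partial>lborel \<partial>lborel)"
      by (rule lborel_pair.Fubini') simp
    also have "\<dots> = (\<integral>\<^sup>+y. \<integral>\<^sup>+x. indicator A (T x - y) * indicator B (T x) \<partial>lborel \<partial>lborel)"
    proof (rule nn_integral_cong)
      fix y
      \<comment> \<open>As \<open>T\<close> is onto, translation by \<open>y\<close> becomes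
        translation of its argument by \<open>d\<close>, under which Lebesgue measure is
        invariant.\<close>
      obtain d where d: "y = T d" using surj by auto
      have "(\<integral>\<^sup>+x. indicator A (T x - y) * indicator B (T x) \<partial>lborel)
          = (\<integral>\<^sup>+x. indicator A (T (d + x) - y) * indicator B (T (d + x)) \<partial>lborel :: ennreal)"
        by (rule nn_integral_lborel_translate[where c = d
              and f = "\<lambda>x. indicator A (T x - y) * indicator B (T x)", symmetric]) simp
      then show "(\<integral>\<^sup>+x. indicator A (T x) * indicator B (T x + y) \<partial>lborel :: ennreal)
          = (\<integral>\<^sup>+x. indicator A (T x - y) * indicator B (T x) \<partial>lborel)"
        by (simp add: d linear_add[OF T] add.commute)
    qed
    also have "\<dots> = (\<integral>\<^sup>+x. \<integral>\<^sup>+y. indicator A (T x - y) * indicator B (T x) \<partial>lborel \<partial>lborel)"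
      by (rule lborel_pair.Fubini') simp
    also have "\<dots> = (\<integral>\<^sup>+x. emeasure lborel A * indicator B (T x) \<partial>lborel)"
    proof (rule nn_integral_cong)
      fix x
      have "(\<integral>\<^sup>+y. indicator A (T x - y) * indicator B (T x) \<partial>lborel :: ennreal)
          = (\<integral>\<^sup>+y. indicator A y * indicator B (T x) \<partial>lborel)"
        by (rule nn_integral_lborel_reflect[where c = "T x"
              and f = "\<lambda>y. indicator A y * indicator B (T x)"]) simp
      then show "(\<integral>\<^sup>+y. indicator A (T x - y) * indicator B (T x) \<partial>lborel :: ennreal)
          = emeasure lborel A * indicator B (T x)"
        by (simp add: nn_integral_multc)
    qed
    also have "\<dots> = (\<integral>\<^sup>+x. indicator B (T x) \<partial>lborel) * emeasure lborel A"
      by (simp add: nn_integral_cmult mult.commute)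
    finally show ?thesis .
  qed
  show ?thesis
  proof (rule measure_eqI)
    fix A assume "A \<in> sets (distr lborel borel T)"
    then have [measurable]: "A \<in> sets borel" by simp
    \<comment> \<open>An isometry fixing 0 preserves the unit ball, whose measure is positive and
      finite and can be cancelled.\<close>
    have "(\<lambda>x. indicator (ball 0 1) (T x) :: ennreal) = indicator (ball 0 1)"
      by (auto simp: fun_eq_iff indicator_def iso)
    then have "(\<integral>\<^sup>+x. indicator A (T x) \<partial>lborel) * emeasure lborel (ball (0::'a) 1)
        = emeasure lborel A * emeasure lborel (ball (0::'a) 1)"
      using swap[of A "ball 0 1"] by (simp add: mult.commute)
    moreover have "emeasure lborel (ball (0::'a) 1) \<noteq> 0"
      using content_ball_pos[of 1 "0::'a"] by (auto simp: measure_def)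
    moreover have "emeasure lborel (ball (0::'a) 1) \<noteq> \<infinity>"
      using emeasure_lborel_ball_finite[of "0::'a" 1] by simp
    ultimately have "(\<integral>\<^sup>+x. indicator A (T x) \<partial>lborel) = emeasure lborel A"
      by (metis ennreal_mult_divide_eq infinity_ennreal_def)
    moreover have "(\<integral>\<^sup>+x. indicator A x \<partial>distr lborel borel T) = (\<integral>\<^sup>+x. indicator A (T x) \<partial>lborel :: ennreal)"
      by (rule nn_integral_distr) simp_all
    ultimately show "emeasure (distr lborel borel T) A = emeasure lborel A" by simp
  qed simp
qed

section \<open>Lebesgue measure on the Hermitian matrices\<close>

lemma hermitian_of_real_in [simp]: "hermitian_of_real X \<in> hermitian_mats"
  by (simp add: hermitian_of_real_def hermitian_mats_def dagger_def vec_eq_iff complex_eq_iff field_simps)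

lemma linear_hermitian_of_real: "linear hermitian_of_real"
  by (rule linearI)
    (simp_all add: hermitian_of_real_def vec_eq_iff complex_eq_iff field_simps)

text \<open>Each entry has squared modulus equal to half the sum of two squares at transposed
  positions, and summing over all positions counts every square fully.\<close>

lemma norm_hermitian_of_real [simp]: "norm (hermitian_of_real X) = norm X"
proof -
  have "hermitian_of_real X \<bullet> hermitian_of_real X
      = (\<Sum>i\<in>UNIV. \<Sum>j\<in>UNIV. (X $ i $ j)\<^sup>2 / 2 + (X $ j $ i)\<^sup>2 / 2)"
  proof -
    have "(x + y) / 2 * ((x + y) / 2) + (x - y) / 2 * ((x - y) / 2) = x\<^sup>2 / 2 + y\<^sup>2 / 2"
      for x y :: real
      by (simp add: power2_eq_square field_simps)
    then show ?thesis
      unfolding inner_vec_def hermitian_of_real_def inner_complex_def vec_lambda_beta complex.sel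
      by (simp only:)
  qed
  also have "\<dots> = (\<Sum>i\<in>UNIV. \<Sum>j\<in>UNIV. (X $ i $ j)\<^sup>2 / 2) + (\<Sum>i\<in>UNIV. \<Sum>j\<in>UNIV. (X $ i $ j)\<^sup>2 / 2)"
    unfolding sum.distrib by (subst (4) sum.swap) simp
  also have "\<dots> = X \<bullet> X"
    unfolding sum.distrib[symmetric] by (simp add: inner_vec_def power2_eq_square)
  finally show ?thesis by (simp add: norm_eq_sqrt_inner)
qed

definition real_of_hermitian :: "complex^'n^'n \<Rightarrow> real^'n^'n" where
  "real_of_hermitian M = (\<chi> i j. Re (M $ i $ j) + Im (M $ i $ j))"

lemma hermitian_of_real_of_hermitian:
  assumes "M \<in> hermitian_mats"
  shows "hermitian_of_real (real_of_hermitian M) = M"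
proof -
  have "hermitian_of_real (real_of_hermitian M) $ i $ j = M $ i $ j" for i j
  proof -
    have "M $ j $ i = cnj (M $ i $ j)"
      using assms by (simp add: hermitian_mats_def dagger_def vec_eq_iff)
    then show ?thesis
      by (simp add: hermitian_of_real_def real_of_hermitian_def complex_eq_iff)
  qed
  then show ?thesis by (simp add: vec_eq_iff)
qed

lemma linear_real_of_hermitian: "linear real_of_hermitian"
  by (rule linearI) (simp_all add: real_of_hermitian_def vec_eq_iff algebra_simps)

text \<open>The squared norm of a Hermitian matrix is the trace of its square, which conjugation
  preserves.\<close>

lemma norm_unitary_conjugation:
  assumes "unitary_mat U" "M \<in> hermitian_mats"
  shows "norm (U ** M ** dagger U) = norm M"
proof -
  have "of_real ((U ** M ** dagger U) \<bullet> (U ** M ** dagger U)) = trace ((U ** M ** dagger U) ** (U ** M ** dagger U))"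
    using assms(2) by (simp add: trace_mult_hermitian hermitian_unitary_conjugation)
  also have "(U ** M ** dagger U) ** (U ** M ** dagger U) = U ** M ** (dagger U ** U) ** M ** dagger U"
    by (simp add: matrix_mul_assoc)
  also have "\<dots> = U ** (M ** M) ** dagger U"
    using assms(1) by (simp add: unitary_mat_def matrix_mul_assoc)
  also have "trace \<dots> = trace (M ** M)" by (rule trace_unitary_conjugation[OF assms(1)])
  also have "\<dots> = of_real (M \<bullet> M)" by (rule trace_mult_hermitian[OF assms(2,2)])
  finally show ?thesis by (simp only: of_real_eq_iff norm_eq_sqrt_inner)
qed

lemma measurable_hermitian:
  fixes f :: "'a :: euclidean_space \<Rightarrow> complex^'n^'n"
  assumes "linear f" "\<And>X. f X \<in> hermitian_mats"
  shows "f \<in> measurable borel (restrict_space borel (hermitian_mats :: (complex^'n^'n) set))"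
  using assms by (intro measurable_restrict_space2 borel_measurable_continuous_onI linear_continuous_on)
    (auto simp: linear_conv_bounded_linear[symmetric])

lemma sets_hermitian_lebesgue [measurable_cong]:
  "sets hermitian_lebesgue = sets (restrict_space borel (hermitian_mats :: (complex^'n^'n) set))"
  by (simp add: hermitian_lebesgue_def)

lemma space_hermitian_lebesgue: "space hermitian_lebesgue = hermitian_mats"
  by (simp add: hermitian_lebesgue_def space_restrict_space)

lemma measurable_hermitian_of_real [measurable]:
  "hermitian_of_real \<in> measurable borel (restrict_space borel hermitian_mats)"
  by (intro measurable_hermitian linear_hermitian_of_real) simp

lemma measurable_unitary_conjugation:
  "(\<lambda>M. U ** M ** dagger U) \<in> measurable (restrict_space borel hermitian_mats) (restrict_space borel hermitian_mats)"
proof -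
  have "(\<lambda>M. U ** M ** dagger U) \<in> borel_measurable borel"
    by (intro borel_measurable_continuous_onI linear_continuous_on)
      (simp add: linear_conv_bounded_linear[symmetric] linear_unitary_conjugation)
  then show ?thesis
    by (intro measurable_restrict_space2 measurable_restrict_space1)
      (auto simp: space_restrict_space intro: hermitian_unitary_conjugation)
qed

text \<open>In the coordinates of \<open>hermitian_of_real\<close>, conjugation is a linear isometry
  \<open>T\<close> of the real matrices and so preserves Lebesgue measure.\<close>

lemma hermitian_lebesgue_invariant:
  assumes U: "unitary_mat U"
  shows "distr hermitian_lebesgue hermitian_lebesgue (\<lambda>M. U ** M ** dagger U) = hermitian_lebesgue"
proof -
  let ?R = "restrict_space borel hermitian_mats"
  let ?\<Phi> = "\<lambda>M. U ** M ** dagger U"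
  define T where "T X = real_of_hermitian (?\<Phi> (hermitian_of_real X))" for X
  have HT: "hermitian_of_real (T X) = ?\<Phi> (hermitian_of_real X)" for X
    unfolding T_def by (intro hermitian_of_real_of_hermitian hermitian_unitary_conjugation) simp
  have linT: "linear T"
    unfolding T_def[abs_def]
    using linear_compose[OF linear_compose[OF linear_hermitian_of_real linear_unitary_conjugation[of U]]
        linear_real_of_hermitian] by (simp add: comp_def)
  have "norm (T X) = norm X" for X
    using norm_hermitian_of_real[of "T X"] norm_unitary_conjugation[OF U, of "hermitian_of_real X"]
    by (simp add: HT)
  then have T: "distr lborel borel T = lborel" using linT by (intro lborel_distr_linear_isometry)
  have [measurable]: "T \<in> borel_measurable borel"
    using linT by (intro borel_measurable_continuous_onI linear_continuous_on)
      (simp add: linear_conv_bounded_linear)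
  note [measurable] = measurable_unitary_conjugation
  have "distr hermitian_lebesgue hermitian_lebesgue ?\<Phi> = distr hermitian_lebesgue ?R ?\<Phi>"
    by (rule distr_cong) (simp_all add: sets_hermitian_lebesgue)
  also have "\<dots> = distr lborel ?R (?\<Phi> \<circ> hermitian_of_real)"
    unfolding hermitian_lebesgue_def by (rule distr_distr) simp_all
  also have "\<dots> = distr lborel ?R (hermitian_of_real \<circ> T)"
    by (simp add: comp_def HT)
  also have "\<dots> = distr (distr lborel borel T) ?R hermitian_of_real"
    by (rule distr_distr[symmetric]) simp_all
  also have "\<dots> = hermitian_lebesgue" unfolding T hermitian_lebesgue_def ..
  finally show ?thesis .
qed

section \<open>The Gaussian weight\<close>

lemma trace_mat_pow_2_hermitian:
  assumes "M \<in> hermitian_mats"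
  shows "trace (mat_pow M 2) = of_real ((norm M)\<^sup>2)"
proof -
  have "mat_pow M 2 = M ** M" by (simp add: mat_pow_def numeral_2_eq_2)
  then show ?thesis
    by (simp only: trace_mult_hermitian[OF assms assms] power2_norm_eq_inner)
qed

lemma measurable_restrict_continuous:
  "continuous_on UNIV f \<Longrightarrow> f \<in> borel_measurable (restrict_space borel S)"
  by (intro measurable_restrict_space1 borel_measurable_continuous_onI)

lemma gaussian_density_measurable:
  "(\<lambda>M :: complex^'n^'n. ennreal (exp (- real CARD('n) * Re (trace (mat_pow M 2)) / 2)))
    \<in> borel_measurable hermitian_lebesgue"
proof -
  have "continuous_on UNIV (\<lambda>M :: complex^'n^'n. trace (mat_pow M 2))"
    using exp_bounded_trace_mat_pow unfolding exp_bounded_def by blast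
  then have "continuous_on UNIV (\<lambda>M :: complex^'n^'n. exp (- real CARD('n) * Re (trace (mat_pow M 2)) / 2))"
    by (intro continuous_intros) auto
  from measurable_restrict_continuous[OF this] show ?thesis
    unfolding measurable_cong_sets[OF sets_hermitian_lebesgue refl] by (rule measurable_compose) simp
qed

text \<open>Both the density, a function of a trace of a power, and the underlying Lebesgue measure
  are invariant.\<close>

lemma gaussian_unitarily_invariant:
  "unitarily_invariant_measure (gaussian :: (complex^'n^'n) measure)"
  unfolding unitarily_invariant_measure_def
proof (intro conjI allI impI)
  show "sets (gaussian :: (complex^'n^'n) measure) = sets (restrict_space borel hermitian_mats)"
    by (simp add: gaussian_def sets_hermitian_lebesgue)
  fix U :: "complex^'n^'n" assume U: "unitary_mat U"
  let ?\<Phi> = "\<lambda>M. U ** M ** dagger U" and ?L = "hermitian_lebesgue :: (complex^'n^'n) measure"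
  let ?f = "\<lambda>M :: complex^'n^'n. ennreal (exp (- real CARD('n) * Re (trace (mat_pow M 2)) / 2))"
  have \<Phi>: "?\<Phi> \<in> measurable ?L ?L"
    unfolding measurable_cong_sets[OF sets_hermitian_lebesgue sets_hermitian_lebesgue]
    by (rule measurable_unitary_conjugation)
  have "?f (?\<Phi> M) = ?f M" for M
    by (simp add: mat_pow_unitary_conjugation[OF U] trace_unitary_conjugation[OF U])
  then have "distr (density ?L ?f) ?L ?\<Phi> = density (distr ?L ?L ?\<Phi>) ?f"
    using density_distr[OF gaussian_density_measurable \<Phi>] by simp
  also have "\<dots> = density ?L ?f" unfolding hermitian_lebesgue_invariant[OF U] ..
  finally show "distr gaussian gaussian ?\<Phi> = gaussian"
    unfolding gaussian_def by (subst distr_cong[of _ _ _ ?L ?\<Phi> ?\<Phi>]) simp_all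
qed

text \<open>Completing the square absorbs the linear term into half of the quadratic one; the other
  half is a centred Gaussian, whose integral is a product over the coordinates.\<close>

lemma integrable_gaussian_norm:
  assumes "0 < a"
  shows "integrable lborel (\<lambda>x :: 'a :: euclidean_space. exp (c * norm x - a * (norm x)\<^sup>2))"
proof -
  \<comment> \<open>The standard deviation for which the normal density is proportional to
    \<open>exp (- (a / 2) * t\<^sup>2)\<close>.\<close>
  define \<sigma> where "\<sigma> = 1 / sqrt a"
  have \<sigma>: "0 < \<sigma>" "1 / (2 * \<sigma>\<^sup>2) = a / 2" using assms by (auto simp: \<sigma>_def power_divide)
  have nd: "exp (- (a / 2) * t\<^sup>2) = sqrt (2 * pi * \<sigma>\<^sup>2) * normal_density 0 \<sigma> t" for t
  proof -
    have "- (a / 2) * t\<^sup>2 = - t\<^sup>2 / (2 * \<sigma>\<^sup>2)" unfolding \<sigma>(2)[symmetric] by simp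
    then show ?thesis using \<sigma>(1) by (simp add: normal_density_def)
  qed
  have "integrable lborel (\<lambda>t. exp (- (a / 2) * t\<^sup>2))"
    unfolding nd using integrable_normal_density[OF \<sigma>(1)] by simp
  then have fin: "(\<integral>\<^sup>+t. exp (- (a / 2) * t\<^sup>2) \<partial>lborel) < \<infinity>"
    by (simp add: integrable_iff_bounded)
  have prod: "exp (- (a / 2) * (norm x)\<^sup>2) = (\<Prod>b\<in>Basis. exp (- (a / 2) * (x \<bullet> b)\<^sup>2))" for x :: 'a
  proof -
    have "(norm x)\<^sup>2 = (\<Sum>b\<in>Basis. (x \<bullet> b)\<^sup>2)"
      unfolding norm_eq_sqrt_inner euclidean_inner[of x x]
      by (simp add: power2_eq_square sum_nonneg)
    then show ?thesis by (simp add: exp_sum[symmetric] sum_distrib_left sum_negf)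
  qed
  have g: "integrable lborel (\<lambda>x :: 'a. exp (- (a / 2) * (norm x)\<^sup>2))"
  proof (rule integrableI_nonneg)
    have "(\<integral>\<^sup>+x. ennreal (exp (- (a / 2) * (norm (x :: 'a))\<^sup>2)) \<partial>lborel)
        = (\<Prod>b\<in>(Basis :: 'a set). (\<integral>\<^sup>+t. exp (- (a / 2) * t\<^sup>2) \<partial>lborel))"
      unfolding prod
      by (subst prod_ennreal[symmetric], simp, rule nn_integral_lborel_prod) auto
    also have "\<dots> < \<infinity>" using fin by (simp add: power_less_top_ennreal)
    finally show "(\<integral>\<^sup>+x. ennreal (exp (- (a / 2) * (norm (x :: 'a))\<^sup>2)) \<partial>lborel) < \<infinity>" .
  qed auto
  show ?thesis
  proof (rule Bochner_Integration.integrable_bound)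
    show "integrable lborel (\<lambda>x :: 'a. exp (c\<^sup>2 / (2 * a)) * exp (- (a / 2) * (norm x)\<^sup>2))"
      using g by (rule integrable_mult_right)
    show "AE x :: 'a in lborel. norm (exp (c * norm x - a * (norm x)\<^sup>2))
        \<le> norm (exp (c\<^sup>2 / (2 * a)) * exp (- (a / 2) * (norm x)\<^sup>2))"
    proof (rule AE_I2)
      fix x :: 'a
      have "0 \<le> (a * norm x - c)\<^sup>2 / (2 * a)" using assms by simp
      also have "\<dots> = c\<^sup>2 / (2 * a) + - (a / 2) * (norm x)\<^sup>2 - (c * norm x - a * (norm x)\<^sup>2)"
        using assms by (simp add: power2_eq_square field_simps)
      finally show "norm (exp (c * norm x - a * (norm x)\<^sup>2))
          \<le> norm (exp (c\<^sup>2 / (2 * a)) * exp (- (a / 2) * (norm x)\<^sup>2))"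
        by (simp add: exp_add[symmetric])
    qed
  qed measurable
qed

text \<open>Pulled back along the isometry \<open>hermitian_of_real\<close>, the integrand is at
  most a constant times \<open>exp (c * norm X - a * (norm X)\<^sup>2)\<close> with
  \<open>a = CARD('n) / 2\<close>.\<close>

lemma integrable_gaussian:
  fixes f :: "complex^'n^'n \<Rightarrow> complex"
  assumes f: "exp_bounded f"
  shows "integrable gaussian f"
proof -
  obtain C c where C: "0 \<le> C" and le: "\<And>M. norm (f M) \<le> C * exp (c * norm M)"
    using exp_boundedE[OF f] by metis
  let ?g = "\<lambda>M :: complex^'n^'n. exp (- real CARD('n) * Re (trace (mat_pow M 2)) / 2)"
  have fm: "f \<in> borel_measurable (restrict_space borel hermitian_mats)"
    using f by (intro measurable_restrict_continuous) (simp add: exp_bounded_def)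
  then have fL: "f \<in> borel_measurable hermitian_lebesgue"
    by (simp only: measurable_cong_sets[OF sets_hermitian_lebesgue refl])
  have gL: "?g \<in> borel_measurable hermitian_lebesgue"
    using borel_measurable_enn2real[OF gaussian_density_measurable] by simp
  then have gm: "?g \<in> borel_measurable (restrict_space borel hermitian_mats)"
    by (simp only: measurable_cong_sets[OF sets_hermitian_lebesgue refl])
  have m: "(\<lambda>M. ?g M *\<^sub>R f M) \<in> borel_measurable (restrict_space borel hermitian_mats)"
    using fm gm by (rule borel_measurable_scaleR[rotated])
  have "integrable lborel (\<lambda>X. ?g (hermitian_of_real X) *\<^sub>R f (hermitian_of_real X))"
  proof (rule Bochner_Integration.integrable_bound)
    show "integrable lborel (\<lambda>X :: real^'n^'n. C * exp (c * norm X - (real CARD('n) / 2) * (norm X)\<^sup>2))"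
      by (intro integrable_mult_right integrable_gaussian_norm) simp
    show "(\<lambda>X. ?g (hermitian_of_real X) *\<^sub>R f (hermitian_of_real X)) \<in> borel_measurable lborel"
      using measurable_compose[OF measurable_hermitian_of_real m] by simp
    show "AE X in lborel. norm (?g (hermitian_of_real X) *\<^sub>R f (hermitian_of_real X))
        \<le> norm (C * exp (c * norm X - (real CARD('n) / 2) * (norm X)\<^sup>2))"
    proof (rule AE_I2)
      fix X :: "real^'n^'n"
      have "?g (hermitian_of_real X) = exp (- (real CARD('n) / 2) * (norm X)\<^sup>2)"
        by (simp add: trace_mat_pow_2_hermitian)
      then have "norm (?g (hermitian_of_real X) *\<^sub>R f (hermitian_of_real X))
          \<le> exp (- (real CARD('n) / 2) * (norm X)\<^sup>2) * (C * exp (c * norm X))"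
        using le[of "hermitian_of_real X"] by (simp add: mult_left_mono)
      also have "\<dots> = C * exp (c * norm X - (real CARD('n) / 2) * (norm X)\<^sup>2)"
        by (simp add: mult.left_commute[of _ C] exp_add[symmetric])
      finally show "norm (?g (hermitian_of_real X) *\<^sub>R f (hermitian_of_real X))
        \<le> norm (C * exp (c * norm X - (real CARD('n) / 2) * (norm X)\<^sup>2))"
        using C by simp
    qed
  qed
  then have "integrable hermitian_lebesgue (\<lambda>M. ?g M *\<^sub>R f M)"
    unfolding hermitian_lebesgue_def by (subst integrable_distr_eq) (use m in auto)
  then show ?thesis
    unfolding gaussian_def by (subst integrable_density) (use fL gL in auto)
qed

text \<open>The total mass is finite, and an everywhere positive density cannot integrate to zero
  against a nonzero measure. This mass is the constant term of the formal partition function at 0,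
  which makes the division possible.\<close>

lemma integral_gaussian_one_neq_0:
  "integral\<^sup>L (gaussian :: (complex^'n^'n) measure) (\<lambda>_. 1 :: complex) \<noteq> 0"
proof -
  let ?G = "gaussian :: (complex^'n^'n) measure"
  let ?f = "\<lambda>M :: complex^'n^'n. ennreal (exp (- real CARD('n) * Re (trace (mat_pow M 2)) / 2))"
  have "integrable ?G (\<lambda>_. 1 :: complex)" by (rule integrable_gaussian) simp
  then have fin: "emeasure ?G (space ?G) < \<infinity>" by (simp add: integrable_iff_bounded)
  have "emeasure ?G (space ?G) \<noteq> 0"
  proof
    assume "emeasure ?G (space ?G) = 0"
    moreover have "emeasure ?G (space ?G)
        = (\<integral>\<^sup>+M. ?f M * indicator (space hermitian_lebesgue) M \<partial>hermitian_lebesgue)"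
      unfolding gaussian_def space_density
      by (rule emeasure_density[OF gaussian_density_measurable sets.top])
    moreover have "\<dots> = (\<integral>\<^sup>+M. ?f M \<partial>hermitian_lebesgue)"
      by (intro nn_integral_cong) simp
    ultimately have "(\<integral>\<^sup>+M. ?f M \<partial>hermitian_lebesgue) = 0" by simp
    then have "AE M in (hermitian_lebesgue :: (complex^'n^'n) measure). False"
      by (subst (asm) nn_integral_0_iff_AE[OF gaussian_density_measurable]) simp
    then have "emeasure (hermitian_lebesgue :: (complex^'n^'n) measure) (space hermitian_lebesgue) = 0"
      using AE_iff_measurable[OF sets.top, of "hermitian_lebesgue :: (complex^'n^'n) measure" "\<lambda>_. False"] by simp
    moreover have "(hermitian_mats :: (complex^'n^'n) set) \<in> sets (restrict_space borel hermitian_mats)"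
      using sets.top[of "restrict_space borel (hermitian_mats :: (complex^'n^'n) set)"]
      by (simp add: space_restrict_space)
    then have "emeasure hermitian_lebesgue (hermitian_mats :: (complex^'n^'n) set)
        = emeasure lborel (hermitian_of_real -` (hermitian_mats :: (complex^'n^'n) set) \<inter> space lborel)"
      unfolding hermitian_lebesgue_def by (intro emeasure_distr) simp_all
    moreover have "hermitian_of_real -` (hermitian_mats :: (complex^'n^'n) set) = UNIV" by auto
    ultimately have "emeasure lborel (UNIV :: (real^'n^'n) set) = 0"
      by (simp add: space_hermitian_lebesgue)
    then show False by simp
  qed
  then show ?thesis using fin by (simp add: measure_def enn2real_eq_0_iff)
qed

section \<open>Formal power series\<close>

lemma finite_subset_mset: "finite {a. a \<subseteq># m}"
proof (induction m)
  case empty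
  then show ?case by simp
next
  case (add x m)
  have "{a. a \<subseteq># add_mset x m} \<subseteq> {a. a \<subseteq># m} \<union> add_mset x ` {a. a \<subseteq># m}"
  proof
    fix a assume "a \<in> {a. a \<subseteq># add_mset x m}"
    then have a: "a \<subseteq># add_mset x m" by simp
    show "a \<in> {a. a \<subseteq># m} \<union> add_mset x ` {a. a \<subseteq># m}"
    proof (cases "x \<in># a")
      case True
      then have "a = add_mset x (a - {#x#})" by simp
      moreover have "a - {#x#} \<subseteq># m" using a by (simp add: subset_eq_diff_conv)
      ultimately show ?thesis by blast
    next
      case False
      have "count a y \<le> count m y" for y
        using mset_subset_eq_count[OF a, of y] False by (cases "y = x") (auto simp: not_in_iff)
      then show ?thesis by (auto intro: mset_subset_eqI)
    qed
  qed
  then show ?case using add by (meson finite_UnI finite_imageI finite_subset)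
qed

lemma finite_strict_subset_mset: "finite {a. a \<subset># m}"
  by (rule finite_subset[OF _ finite_subset_mset[of m]]) auto

text \<open>Isolating the leading coefficient \<open>q m\<close> turns the equation
  \<open>pseries_mult q g = f\<close> into a recursion over proper submonomials.\<close>

lemma pseries_mult_split:
  "pseries_mult q g m = q m * g {#} + (\<Sum>a | a \<subset># m. q a * g (m - a))"
proof -
  have "{a. a \<subseteq># m} = insert m {a. a \<subset># m}" by (auto simp: subset_mset.le_less)
  then show ?thesis
    unfolding pseries_mult_def using finite_strict_subset_mset[of m] by simp
qed

function pseries_quotient :: "pseries \<Rightarrow> pseries \<Rightarrow> pseries" where
  "pseries_quotient f g m =
    (f m - (\<Sum>a | a \<subset># m. pseries_quotient f g a * g (m - a))) / g {#}"
  by pat_completeness auto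
termination
  by (relation "Wellfounded.measure (\<lambda>(f, g, m). size m)") (auto simp: mset_subset_size)

declare pseries_quotient.simps [simp del]

lemma pseries_div_eq_quotient:
  assumes g: "g {#} \<noteq> 0"
  shows "pseries_div f g = pseries_quotient f g"
  unfolding pseries_div_def
proof (rule the_equality)
  show "pseries_mult (pseries_quotient f g) g = f"
  proof
    fix m
    show "pseries_mult (pseries_quotient f g) g m = f m"
      unfolding pseries_mult_split by (subst pseries_quotient.simps) (simp add: g)
  qed
  fix q assume q: "pseries_mult q g = f"
  show "q = pseries_quotient f g"
  proof
    fix m
    show "q m = pseries_quotient f g m"
    proof (induction "size m" arbitrary: m rule: less_induct)
      case less
      have "q m * g {#} = f m - (\<Sum>a | a \<subset># m. q a * g (m - a))"
        using fun_cong[OF q, of m] unfolding pseries_mult_split by (simp add: algebra_simps)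
      also have "\<dots> = f m - (\<Sum>a | a \<subset># m. pseries_quotient f g a * g (m - a))"
        using less mset_subset_size by (intro arg_cong2[where f = "(-)"] sum.cong refl) auto
      finally show ?case by (subst pseries_quotient.simps) (simp add: field_simps g)
    qed
  qed
qed

text \<open>The recursion expresses a coefficient of the quotient through finitely many coefficients
  of \<open>f\<close>. The factors \<open>\<kappa>\<close> are the same for all \<open>f\<close>, so
  that one weight will serve every integrand.\<close>

lemma pseries_div_linear_combination:
  assumes g: "g {#} \<noteq> 0"
  obtains \<kappa> where "\<And>f. pseries_div f g m = (\<Sum>a | a \<subseteq># m. \<kappa> a * f a)"
proof -
  have "\<exists>\<kappa>. \<forall>f. pseries_quotient f g m = (\<Sum>a | a \<subseteq># m. \<kappa> a * f a)"
  proof (induction "size m" arbitrary: m rule: less_induct)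
    case less
    have "\<forall>a. \<exists>\<kappa>. a \<subset># m \<longrightarrow> (\<forall>f. pseries_quotient f g a = (\<Sum>b | b \<subseteq># a. \<kappa> b * f b))"
      using less mset_subset_size by blast
    then obtain \<kappa> where \<kappa>: "\<And>a f. a \<subset># m \<Longrightarrow> pseries_quotient f g a = (\<Sum>b | b \<subseteq># a. \<kappa> a b * f b)"
      by metis
    \<comment> \<open>Extension by zero makes all inner sums run over the submonomials of
      \<open>m\<close>, so that they can be interchanged.\<close>
    define \<kappa>' where "\<kappa>' a b = (if b \<subseteq># a then \<kappa> a b else 0)" for a b
    have \<kappa>': "pseries_quotient f g a = (\<Sum>b | b \<subseteq># m. \<kappa>' a b * f b)" if "a \<subset># m" for a f
      unfolding \<kappa>[OF that] using that
      by (intro sum.mono_neutral_cong_left finite_subset_mset)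
        (auto simp: \<kappa>'_def intro: subset_mset.order_trans subset_mset.less_imp_le)
    have "pseries_quotient f g m = (\<Sum>b | b \<subseteq># m.
        ((if b = m then 1 else 0) - (\<Sum>a | a \<subset># m. \<kappa>' a b * g (m - a))) / g {#} * f b)" for f
    proof -
      have "(\<Sum>a | a \<subset># m. pseries_quotient f g a * g (m - a))
          = (\<Sum>a | a \<subset># m. \<Sum>b | b \<subseteq># m. \<kappa>' a b * f b * g (m - a))"
        by (intro sum.cong refl) (simp add: \<kappa>' sum_distrib_right)
      also have "\<dots> = (\<Sum>b | b \<subseteq># m. (\<Sum>a | a \<subset># m. \<kappa>' a b * g (m - a)) * f b)"
        by (subst sum.swap) (simp add: sum_distrib_left sum_distrib_right mult_ac)
      finally have s: "(\<Sum>a | a \<subset># m. pseries_quotient f g a * g (m - a))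
          = (\<Sum>b | b \<subseteq># m. (\<Sum>a | a \<subset># m. \<kappa>' a b * g (m - a)) * f b)" .
      have "f m = (\<Sum>b | b \<subseteq># m. (if b = m then 1 else 0) * f b)"
        by (simp add: finite_subset_mset if_distrib[of "\<lambda>x. x * _"] cong: if_cong)
      then have "pseries_quotient f g m = ((\<Sum>b | b \<subseteq># m. (if b = m then 1 else 0) * f b)
          - (\<Sum>b | b \<subseteq># m. (\<Sum>a | a \<subset># m. \<kappa>' a b * g (m - a)) * f b)) / g {#}"
        by (subst pseries_quotient.simps) (simp only: s)
      then show ?thesis
        by (simp only: sum_subtractf[symmetric] sum_divide_distrib left_diff_distrib[symmetric] times_divide_eq_left)
    qed
    then show ?case by (intro exI allI)
  qed
  then show ?thesis using that unfolding pseries_div_eq_quotient[of g, OF g] by blast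
qed

section \<open>Weights of the formal measures\<close>

lemma exp_bounded_vertex: "exp_bounded (\<lambda>M. vertex M i)"
proof -
  obtain h ds where i: "i = (h, ds)" by fastforce
  have "exp_bounded (\<lambda>M. \<Prod>d\<leftarrow>ds. trace (mat_pow M d))"
    by (induction ds) auto
  then show ?thesis unfolding vertex_def i prod.case by (intro exp_bounded_mult) auto
qed

lemma exp_bounded_map_weight: "exp_bounded (\<lambda>M. map_weight K M m)"
proof (cases "set_mset m \<subseteq> K")
  case True
  have "exp_bounded (\<lambda>M. \<Prod>i\<in>set_mset m. vertex M i ^ count m i * inverse (fact (count m i)))"
    by (intro exp_bounded_prod exp_bounded_mult exp_bounded_power exp_bounded_vertex) simp
  then show ?thesis using True by (simp add: map_weight_def divide_inverse)
qed (simp add: map_weight_def)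

lemma map_weight_unitary_conjugation:
  "unitary_mat U \<Longrightarrow> map_weight K (U ** M ** dagger U) m = map_weight K M m"
  by (simp add: map_weight_def vertex_def mat_pow_unitary_conjugation trace_unitary_conjugation)

lemma ext_weight_0 [simp]: "ext_weight 0 M = 1"
  by (simp add: ext_weight_def trace_def)

section \<open>The expansion of the partition function\<close>

theorem proposition1p4:
  fixes idx :: "nat \<Rightarrow> 'n::finite"
    and \<gamma> :: "nat multiset \<Rightarrow> nat \<Rightarrow> nat"
  assumes idx: "bij_betw idx {1..CARD('n)} UNIV"
    and \<gamma>: "\<And>p. p \<in> partitions \<Longrightarrow> \<gamma> p \<in> conj_class p"
  shows
    "(\<forall>\<mu> :: (complex^'n^'n) measure.
       unitarily_invariant_measure \<mu> \<longrightarrow>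
       emeasure \<mu> (space \<mu>) \<noteq> 0 \<longrightarrow>
       (\<forall>A\<in>hermitian_mats. integrable \<mu> (ext_weight A)) \<longrightarrow>
       (\<lambda>A. ext_partition \<mu> A / ext_partition \<mu> 0
            - power_sum_expansion (\<lambda>p. mean \<mu> (perm_obs idx (sum_mset p) (\<gamma> p))) A)
         \<in> O[at 0 within hermitian_mats](\<lambda>A. of_real (norm A ^ (CARD('n) + 1))))
     \<and>
     (\<forall>K \<in> {usual_params, loop_params, stuffed_params}. \<forall>m.
       (\<lambda>A. pseries_div (formal_ext_partition K A) (formal_ext_partition K (0 :: complex^'n^'n)) m
            - power_sum_expansion (\<lambda>p. formal_mean K (perm_obs idx (sum_mset p) (\<gamma> p)) m) A)
         \<in> O[at 0 within hermitian_mats](\<lambda>A :: complex^'n^'n. of_real (norm A ^ (CARD('n) + 1))))"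
proof (intro conjI allI impI ballI)
  have \<gamma>': "\<forall>p\<in>partitions. \<gamma> p \<in> conj_class p" using \<gamma> by blast
  {
    fix \<mu> :: "(complex^'n^'n) measure"
    assume inv: "unitarily_invariant_measure \<mu>"
      and int: "\<forall>A\<in>hermitian_mats. integrable \<mu> (ext_weight A)"
    \<comment> \<open>With the normalisation in the weight, the means and the quotient of partition
      functions become integrals against the same weight.\<close>
    define c where "c = 1 / integral\<^sup>L \<mu> (\<lambda>_. 1 :: complex)"
    interpret invariant_weight \<mu> "\<lambda>_. c"
      by unfold_locales (use inv int in auto)
    have "mean \<mu> f = (LINT M|\<mu>. c * f M)" for f
      by (simp add: mean_def c_def)
    moreover have "ext_partition \<mu> A / ext_partition \<mu> 0 = (LINT M|\<mu>. c * ext_weight A M)" for A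
    proof -
      have "ext_partition \<mu> 0 = integral\<^sup>L \<mu> (\<lambda>_. 1)"
        unfolding ext_partition_def by (intro arg_cong[where f = "integral\<^sup>L \<mu>"] ext) simp
      then show ?thesis by (simp add: ext_partition_def c_def)
    qed
    ultimately show "(\<lambda>A. ext_partition \<mu> A / ext_partition \<mu> 0
            - power_sum_expansion (\<lambda>p. mean \<mu> (perm_obs idx (sum_mset p) (\<gamma> p))) A)
         \<in> O[at 0 within hermitian_mats](\<lambda>A. of_real (norm A ^ (CARD('n) + 1)))"
      using expansion_bigo[OF idx \<gamma>'] by presburger
  next
    fix K :: "param set" and m
    define Z where "Z = formal_integral K (\<lambda>_ :: complex^'n^'n. 1)"
    \<comment> \<open>At the empty monomial the map weight is 1, so this coefficient is the total
      Gaussian mass.\<close>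
    have "Z {#} \<noteq> 0"
      using integral_gaussian_one_neq_0[where 'n = 'n]
      by (simp add: Z_def formal_integral_def map_weight_def)
    from this obtain \<kappa> where
      \<kappa>: "\<And>f. pseries_div f Z m = (\<Sum>a | a \<subseteq># m. \<kappa> a * f a)"
      by (rule pseries_div_linear_combination[of Z m]) blast
    \<comment> \<open>For each fixed monomial \<open>m\<close>, dividing by \<open>Z\<close> and
      taking the coefficient at \<open>m\<close> amounts to Gaussian integration against this
      weight.\<close>
    define w where "w M = (\<Sum>a | a \<subseteq># m. \<kappa> a * map_weight K M a)" for M :: "complex^'n^'n"
    have w: "exp_bounded w"
      unfolding w_def by (intro exp_bounded_sum exp_bounded_mult exp_bounded_map_weight) simp
    interpret invariant_weight gaussian w
    proof
      show "w (U ** M ** dagger U) = w M" if "unitary_mat U" for U M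
        unfolding w_def map_weight_unitary_conjugation[OF that] ..
      show "integrable gaussian (\<lambda>M. w M * ext_weight A M)" for A
        by (intro integrable_gaussian exp_bounded_mult w exp_bounded_ext_weight)
    qed (rule gaussian_unitarily_invariant)
    have div: "pseries_div (formal_integral K f) Z m = (LINT M|gaussian. w M * f M)"
      if f: "exp_bounded f" for f :: "complex^'n^'n \<Rightarrow> complex"
    proof -
      have "(LINT M|gaussian. w M * f M)
          = (LINT M|gaussian. (\<Sum>a | a \<subseteq># m. \<kappa> a * (map_weight K M a * f M)))"
        by (simp add: w_def sum_distrib_right mult.assoc)
      also have "\<dots> = (\<Sum>a | a \<subseteq># m. \<kappa> a * (LINT M|gaussian. map_weight K M a * f M))"
        by (subst Bochner_Integration.integral_sum, (intro integrable_mult_right integrable_gaussian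
              exp_bounded_mult exp_bounded_map_weight f)[1], simp only: integral_mult_right_zero)
      finally show ?thesis unfolding \<kappa> formal_integral_def by simp
    qed
    have Z: "formal_ext_partition K (0 :: complex^'n^'n) = Z"
      unfolding formal_ext_partition_def Z_def by (intro arg_cong[where f = "formal_integral K"] ext) simp
    have "exp_bounded (perm_obs idx k g)" for k g
      unfolding perm_obs_def[abs_def] by (intro exp_bounded_prod) simp
    then have mean: "formal_mean K (perm_obs idx k g) m = (LINT M|gaussian. w M * perm_obs idx k g M)" for k g
      unfolding formal_mean_def Z_def[symmetric] by (rule div)
    have ext: "pseries_div (formal_ext_partition K A) (formal_ext_partition K (0 :: complex^'n^'n)) m
        = (LINT M|gaussian. w M * ext_weight A M)" for A :: "complex^'n^'n"
      unfolding Z unfolding formal_ext_partition_def by (intro div exp_bounded_ext_weight)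
    show "(\<lambda>A. pseries_div (formal_ext_partition K A) (formal_ext_partition K (0 :: complex^'n^'n)) m
            - power_sum_expansion (\<lambda>p. formal_mean K (perm_obs idx (sum_mset p) (\<gamma> p)) m) A)
         \<in> O[at 0 within hermitian_mats](\<lambda>A :: complex^'n^'n. of_real (norm A ^ (CARD('n) + 1)))"
      unfolding mean ext by (rule expansion_bigo[OF idx \<gamma>'])
  }
qed

end
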